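(* Let $1\leq q\leq p<\infty$ and let $\Omega\subset\mathbb R^n$ be a $p$-Poincaré domain. If $\Omega$ is a $(W^{1,p},W^{1,q})$-extension domain, then $\Omega$ is also an $(L^{1,p},L^{1,q})$-extension domain.
   Context: For a domain $\Omega\subset\mathbb R^n$ and $1\leq p<\infty$: $L^{1,p}(\Omega)$ (homogeneous Sobolev space) is the space of $u\in L^1_{\rm loc}(\Omega)$ that are weakly differentiable with $\nabla u\in L^p(\Omega;\mathbb R^n)$, with seminorm $\|u\|_{L^{1,p}(\Omega)}=\|\nabla u\|_{L^p(\Omega)}$; $W^{1,p}(\Omega)=L^{1,p}(\Omega)\cap L^p(\Omega)$ with norm $(\int_\Omega |u|^p+|\nabla u|^p)^{1/p}$. Given (semi)normed spaces $\mathcal X(\Omega)$ of functions on $\Omega$ and $\mathcal Y(\mathbb R^n)$ of functions on $\mathbb R^n$, $\Omega$ is an $(\mathcal X,\mathcal Y)$-extension domain if there is an operator $E:\mathcal X(\Omega)\to\mathcal Y(\mathbb R^n)$ and a constant $C>0$ such that for every $u\in\mathcal X(\Omega)$, $E(u)|_\Omega=u$ and $\|E(u)\|_{\mathcal Y}\leq C\|u\|_{\mathcal X}$. A bounded domain $\Omega$ is a $p$-Poincaré domain if there is $C>0$ with $\int_\Omega|u-u_\Omega|^p\,dx\leq C\int_\Omega|\nabla u|^p\,dx$ for every $u\in W^{1,p}(\Omega)$, where $u_\Omega$ is the mean value of $u$ over $\Omega$. *)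

theory Defs
  imports "HOL-Analysis.Analysis"
begin

text \<open>Infinitely differentiable real-valued functions on the whole space:
  differentiable everywhere, and every directional derivative is again smooth
  (greatest fixed point, i.e. all iterated derivatives exist).\<close>
coinductive smooth_fun :: "('a::euclidean_space \<Rightarrow> real) \<Rightarrow> bool" where
  "f differentiable_on UNIV \<Longrightarrow> (\<forall>v. smooth_fun (\<lambda>x. frechet_derivative f (at x) v))
     \<Longrightarrow> smooth_fun f"

definition test_fun :: "'a::euclidean_space set \<Rightarrow> ('a \<Rightarrow> real) \<Rightarrow> bool" where
  "test_fun \<Omega> \<phi> \<longleftrightarrow> smooth_fun \<phi> \<and> compact (closure {x. \<phi> x \<noteq> 0})
      \<and> closure {x. \<phi> x \<noteq> 0} \<subseteq> \<Omega>"

definition L1_loc :: "'a::euclidean_space set \<Rightarrow> ('a \<Rightarrow> 'b::euclidean_space) \<Rightarrow> bool" where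
  "L1_loc \<Omega> u \<longleftrightarrow> u \<in> borel_measurable (lebesgue_on \<Omega>)
      \<and> (\<forall>K. compact K \<and> K \<subseteq> \<Omega> \<longrightarrow> set_integrable lebesgue K u)"

definition weak_grad :: "'a::euclidean_space set \<Rightarrow> ('a \<Rightarrow> real) \<Rightarrow> ('a \<Rightarrow> 'a) \<Rightarrow> bool" where
  "weak_grad \<Omega> u g \<longleftrightarrow> L1_loc \<Omega> u \<and> L1_loc \<Omega> g \<and>
     (\<forall>\<phi>. test_fun \<Omega> \<phi> \<longrightarrow> (\<forall>i\<in>Basis.
        (LINT x:\<Omega>|lebesgue. u x * frechet_derivative \<phi> (at x) i)
          = - (LINT x:\<Omega>|lebesgue. (g x \<bullet> i) * \<phi> x)))"

definition L1p :: "'a::euclidean_space set \<Rightarrow> real \<Rightarrow> ('a \<Rightarrow> real) \<Rightarrow> bool" where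
  "L1p \<Omega> p u \<longleftrightarrow> (\<exists>g. weak_grad \<Omega> u g \<and> set_integrable lebesgue \<Omega> (\<lambda>x. norm (g x) powr p))"

definition wgrad :: "'a::euclidean_space set \<Rightarrow> ('a \<Rightarrow> real) \<Rightarrow> ('a \<Rightarrow> 'a)" where
  "wgrad \<Omega> u = (SOME g. weak_grad \<Omega> u g)"

definition L1p_norm :: "'a::euclidean_space set \<Rightarrow> real \<Rightarrow> ('a \<Rightarrow> real) \<Rightarrow> real" where
  "L1p_norm \<Omega> p u = (LINT x:\<Omega>|lebesgue. norm (wgrad \<Omega> u x) powr p) powr (1/p)"

definition W1p :: "'a::euclidean_space set \<Rightarrow> real \<Rightarrow> ('a \<Rightarrow> real) \<Rightarrow> bool" where
  "W1p \<Omega> p u \<longleftrightarrow> L1p \<Omega> p u \<and> set_integrable lebesgue \<Omega> (\<lambda>x. \<bar>u x\<bar> powr p)"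

definition W1p_norm :: "'a::euclidean_space set \<Rightarrow> real \<Rightarrow> ('a \<Rightarrow> real) \<Rightarrow> real" where
  "W1p_norm \<Omega> p u = ((LINT x:\<Omega>|lebesgue. \<bar>u x\<bar> powr p)
      + (LINT x:\<Omega>|lebesgue. norm (wgrad \<Omega> u x) powr p)) powr (1/p)"

text \<open>Omega is an (X,Y)-extension domain: X/nX describe the space on Omega,
  Y/nY the space on the whole space. Restriction is understood almost everywhere
  (Sobolev functions are equivalence classes).\<close>
definition extension_domain ::
  "'a::euclidean_space set \<Rightarrow> (('a \<Rightarrow> real) \<Rightarrow> bool) \<Rightarrow> (('a \<Rightarrow> real) \<Rightarrow> real)
     \<Rightarrow> (('a \<Rightarrow> real) \<Rightarrow> bool) \<Rightarrow> (('a \<Rightarrow> real) \<Rightarrow> real) \<Rightarrow> bool" where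
  "extension_domain \<Omega> X nX Y nY \<longleftrightarrow> (\<exists>E C. C > 0 \<and> (\<forall>u. X u \<longrightarrow>
      Y (E u) \<and> (AE x in lebesgue. x \<in> \<Omega> \<longrightarrow> E u x = u x) \<and> nY (E u) \<le> C * nX u))"

definition is_domain :: "'a::euclidean_space set \<Rightarrow> bool" where
  "is_domain \<Omega> \<longleftrightarrow> open \<Omega> \<and> connected \<Omega> \<and> \<Omega> \<noteq> {}"

definition poincare_domain :: "real \<Rightarrow> 'a::euclidean_space set \<Rightarrow> bool" where
  "poincare_domain p \<Omega> \<longleftrightarrow> is_domain \<Omega> \<and> bounded \<Omega> \<and>
     (\<exists>C>0. \<forall>u. W1p \<Omega> p u \<longrightarrow>
        (LINT x:\<Omega>|lebesgue. \<bar>u x - (LINT y:\<Omega>|lebesgue. u y) / measure lebesgue \<Omega>\<bar> powr p)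
          \<le> C * (LINT x:\<Omega>|lebesgue. norm (wgrad \<Omega> u x) powr p))"

end

theory Submission
  imports Defs "HOL-Computational_Algebra.Polynomial"
begin

text \<open>On a \<open>p\<close>-Poincare domain every \<open>u\<close> in \<open>L\<^sup>1\<^sup>,\<^sup>p\<close> already lies in \<open>L\<^sup>p\<close>: the Poincare inequality applies to
  the bounded functions \<open>k sin (u/k)\<close> by the chain rule for weak gradients, and Fatou's lemma passes to
  the limit. Hence \<open>u - m\<close>, with \<open>m\<close> the mean value of \<open>u\<close>, lies in \<open>W\<^sup>1\<^sup>,\<^sup>p\<close> with norm controlled by the
  gradient of \<open>u\<close> alone, and \<open>E (u - m) + m\<close> is the required extension, where \<open>E\<close> is the given
  extension operator. The chain rule and the uniqueness of weak gradients come from mollification.\<close>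

section \<open>Smooth functions\<close>

text \<open>The Poincare inequality is available only for functions already known to lie in L^p,
  whereas a function with gradient in L^p is a priori only locally integrable on Omega; so it has to
  be truncated before the inequality applies. Sine gives a continuously differentiable truncation: k
  sin (u/k) is bounded by k, dominated by |u|, and its gradient is that of u times a cosine. A chain
  rule for C^1 functions with bounded derivative therefore suffices, where cutting off with min and
  max would call for one at corners. The inequality controls only the deviation of each truncation
  from its own mean value, so the mean values need a bound of their own, uniform in k. Uniqueness
  enters because \<open>wgrad\<close> is an arbitrary choice among weak gradients: the estimate for
  the truncations has to replace it by the gradient that the chain rule produces. The extension
  constant is D (C + 1)^(1/p), with D from the given operator and C from the Poincare inequality:
  the p-th power of the norm of u - m is at most C + 1 times that of the gradient.\<close>

lemma smooth_fun_differentiable: "smooth_fun f \<Longrightarrow> f differentiable at x"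
  by (auto elim!: smooth_fun.cases simp: differentiable_on_def)

lemma smooth_fun_derivative: "smooth_fun f \<Longrightarrow> smooth_fun (\<lambda>x. frechet_derivative f (at x) v)"
  by (auto elim!: smooth_fun.cases)

lemma smooth_fun_has_derivative:
  "smooth_fun f \<Longrightarrow> (f has_derivative frechet_derivative f (at x)) (at x)"
  by (meson frechet_derivative_works smooth_fun_differentiable)

lemma smooth_fun_continuous: "smooth_fun f \<Longrightarrow> continuous_on A f"
  by (meson continuous_at_imp_continuous_on differentiable_imp_continuous_within smooth_fun_differentiable)

lemma smooth_fun_measurable: "smooth_fun f \<Longrightarrow> f \<in> borel_measurable borel"
  by (simp add: borel_measurable_continuous_onI smooth_fun_continuous)

text \<open>Later calculus runs along lines: for mollifications only directional derivatives are
  established, and this brings smooth functions to the same form.\<close>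

lemma smooth_fun_directional_derivative:
  assumes "smooth_fun f"
  shows "((\<lambda>t. f (x + t *\<^sub>R v)) has_real_derivative frechet_derivative f (at x) v) (at 0)"
proof -
  have D: "(f has_derivative frechet_derivative f (at x)) (at (x + 0 *\<^sub>R v))"
    using smooth_fun_has_derivative[OF assms] by simp
  have "((\<lambda>t. x + t *\<^sub>R v) has_derivative (\<lambda>t. t *\<^sub>R v)) (at 0)"
    by (auto intro!: derivative_eq_intros)
  from has_derivative_compose[OF this D]
  have "((\<lambda>t. f (x + t *\<^sub>R v)) has_derivative (\<lambda>t. frechet_derivative f (at x) (t *\<^sub>R v))) (at 0)" .
  moreover have "frechet_derivative f (at x) (t *\<^sub>R v) = frechet_derivative f (at x) v * t" for t
    using D by (simp add: has_derivative_def bounded_linear.linear linear_scale)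
  ultimately show ?thesis by (simp add: has_field_derivative_def)
qed

text \<open>Lets a coinduction name a derivative \<open>D\<close> of its own; uniqueness of the
  derivative identifies it with the \<open>frechet_derivative\<close> that
  \<open>smooth_fun.coinduct\<close> speaks of.\<close>

lemma smooth_fun_coinduct_derivative:
  assumes "X f"
    and step: "\<And>f. X f \<Longrightarrow> \<exists>D. \<forall>x. (f has_derivative D x) (at x) \<and> (\<forall>v. X (\<lambda>x. D x v) \<or> smooth_fun (\<lambda>x. D x v))"
  shows "smooth_fun f"
  using assms(1)
proof (coinduction arbitrary: f rule: smooth_fun.coinduct)
  case smooth_fun
  from step[OF this] obtain D where D: "\<And>x. (f has_derivative D x) (at x)"
    "\<And>v. X (\<lambda>x. D x v) \<or> smooth_fun (\<lambda>x. D x v)" by blast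
  have "frechet_derivative f (at x) = D x" for x
    using frechet_derivative_at[OF D(1)] by simp
  then show ?case
    using D by (auto simp: differentiable_on_def differentiable_def intro: has_derivative_at_withinI)
qed

lemma smooth_fun_const: "smooth_fun (\<lambda>_::'a::euclidean_space. c)"
proof (rule smooth_fun_coinduct_derivative[where X="\<lambda>f. \<exists>c. f = (\<lambda>_. c)"])
  fix f :: "'a \<Rightarrow> real" assume "\<exists>c. f = (\<lambda>_. c)"
  then show "\<exists>D. \<forall>x. (f has_derivative D x) (at x) \<and>
      (\<forall>v. (\<exists>c. (\<lambda>x. D x v) = (\<lambda>_. c)) \<or> smooth_fun (\<lambda>x. D x v))"
    by (intro exI[of _ "\<lambda>x v. 0"]) auto
qed auto

text \<open>Products are not closed under derivation, finite sums of products are.\<close>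
inductive sum_of_smooth_products :: "('a::euclidean_space \<Rightarrow> real) \<Rightarrow> bool" where
  "smooth_fun f \<Longrightarrow> smooth_fun g \<Longrightarrow> sum_of_smooth_products (\<lambda>x. f x * g x)"
| "sum_of_smooth_products f \<Longrightarrow> sum_of_smooth_products g \<Longrightarrow> sum_of_smooth_products (\<lambda>x. f x + g x)"

lemma smooth_fun_mult:
  fixes f g :: "'a::euclidean_space \<Rightarrow> real"
  assumes "smooth_fun f" "smooth_fun g"
  shows "smooth_fun (\<lambda>x. f x * g x)"
proof (rule smooth_fun_coinduct_derivative[where X=sum_of_smooth_products])
  show "sum_of_smooth_products (\<lambda>x. f x * g x)"
    using assms by (rule sum_of_smooth_products.intros)
next
  fix h :: "'a \<Rightarrow> real" assume "sum_of_smooth_products h"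
  then have "\<exists>D. \<forall>x. (h has_derivative D x) (at x) \<and> (\<forall>v. sum_of_smooth_products (\<lambda>x. D x v))"
  proof induction
    case (1 f g)
    then show ?case
      by (intro exI[of _ "\<lambda>x v. f x * frechet_derivative g (at x) v + frechet_derivative f (at x) v * g x"])
        (auto intro!: has_derivative_mult sum_of_smooth_products.intros
          intro: smooth_fun_has_derivative smooth_fun_derivative)
  next
    case (2 f g)
    then obtain D E where "\<forall>x. (f has_derivative D x) (at x) \<and> (\<forall>v. sum_of_smooth_products (\<lambda>x. D x v))"
      "\<forall>x. (g has_derivative E x) (at x) \<and> (\<forall>v. sum_of_smooth_products (\<lambda>x. E x v))" by blast
    then show ?case
      by (intro exI[of _ "\<lambda>x v. D x v + E x v"])
        (auto intro!: has_derivative_add intro: sum_of_smooth_products.intros)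
  qed
  then show "\<exists>D. \<forall>x. (h has_derivative D x) (at x) \<and>
      (\<forall>v. sum_of_smooth_products (\<lambda>x. D x v) \<or> smooth_fun (\<lambda>x. D x v))" by blast
qed

lemma smooth_fun_prod:
  assumes "finite I" "\<And>i. i \<in> I \<Longrightarrow> smooth_fun (f i)"
  shows "smooth_fun (\<lambda>x. \<Prod>i\<in>I. f i x)"
  using assms by (induction I) (auto intro: smooth_fun_const smooth_fun_mult)

text \<open>This family contains \<open>exp (-1/t)\<close> on the positive axis and is closed under derivation.\<close>
definition flat_fun :: "real poly \<Rightarrow> real \<Rightarrow> real" where
  "flat_fun P t = (if t > 0 then poly P (1/t) * exp (- 1/t) else 0)"

lemma poly_exp_tendsto_0: "((\<lambda>s. poly P s * exp (- s)) \<longlongrightarrow> (0::real)) at_top"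
proof -
  have "((\<lambda>s. \<Sum>i\<le>degree P. coeff P i * (s ^ i / exp s)) \<longlongrightarrow> (\<Sum>i\<le>degree P. coeff P i * 0)) at_top"
    by (intro tendsto_intros tendsto_power_div_exp_0)
  then show ?thesis
    by (simp add: poly_altdef sum_divide_distrib exp_minus field_simps)
qed

text \<open>With s = 1/t one has d/dt = - s^2 d/ds, which sends P(s) exp(-s) to s^2 (P - P')(s)
  exp(-s); \<open>[:0,0,1:]\<close> is s^2.\<close>

definition flat_pderiv :: "real poly \<Rightarrow> real poly" where
  "flat_pderiv P = (P - pderiv P) * [:0,0,1:]"

lemma flat_fun_has_derivative:
  "(flat_fun P has_real_derivative flat_fun (flat_pderiv P) t) (at t)"
proof -
  consider "t > 0" | "t < 0" | "t = 0" by linarith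
  then show ?thesis
  proof cases
    case 1
    have "((\<lambda>t. poly P (1/t) * exp (- 1/t)) has_real_derivative flat_fun (flat_pderiv P) t) (at t)"
      using 1 by (auto intro!: derivative_eq_intros simp: flat_fun_def flat_pderiv_def field_simps power2_eq_square)
    then show ?thesis
      by (rule DERIV_cong_ev[OF refl _ refl, THEN iffD1, rotated])
        (use 1 in \<open>auto simp: flat_fun_def intro!: eventually_mono[OF order_tendstoD(1)[OF tendsto_ident_at]]
          eventually_nhds_in_open[of "{0<..}", THEN eventually_mono]\<close>)
  next
    case 2
    have "((\<lambda>t. 0) has_real_derivative 0) (at t)" by simp
    then have "(flat_fun P has_real_derivative 0) (at t)"
      by (rule DERIV_cong_ev[OF refl _ refl, THEN iffD1, rotated])
        (use 2 in \<open>auto simp: flat_fun_def intro!: eventually_nhds_in_open[of "{..<0}", THEN eventually_mono]\<close>)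
    then show ?thesis using 2 by (simp add: flat_fun_def)
  next
    case 3
    \<comment> \<open>At 0 the right difference quotient is s P(s) exp(-s) with s = 1/h; the factor
      \<open>[:0,1:]\<close> is the division by h.\<close>
    have "((\<lambda>h. poly ([:0,1:] * P) (inverse h) * exp (- inverse h)) \<longlongrightarrow> 0) (at_right (0::real))"
      using poly_exp_tendsto_0[of "[:0,1:] * P"] filterlim_inverse_at_top_right
      by (rule filterlim_compose)
    then have "((\<lambda>h. flat_fun P h / h) \<longlongrightarrow> 0) (at_right 0)"
      by (rule Lim_transform_eventually)
        (auto simp: eventually_at_filter flat_fun_def divide_inverse)
    moreover have "((\<lambda>h. flat_fun P h / h) \<longlongrightarrow> 0) (at_left 0)"
      by (rule Lim_transform_eventually[OF tendsto_const]) (auto simp: eventually_at_filter flat_fun_def)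
    ultimately have "((\<lambda>h. flat_fun P h / h) \<longlongrightarrow> 0) (at 0)"
      by (simp add: filterlim_split_at_real)
    then show ?thesis using 3 by (simp add: DERIV_def flat_fun_def)
  qed
qed

text \<open>Differentiating in direction v produces the extra scalar v . b from the chain rule. It
  is absorbed into the polynomial, so quantifying over all \<open>P\<close> gives an invariant for
  the coinduction.\<close>

lemma smooth_fun_flat:
  fixes b :: "'a::euclidean_space"
  shows "smooth_fun (\<lambda>x. flat_fun P (c + x \<bullet> b))"
proof (rule smooth_fun_coinduct_derivative[where X="\<lambda>h. \<exists>P. h = (\<lambda>x. flat_fun P (c + x \<bullet> b))"])
  fix h :: "'a \<Rightarrow> real" assume "\<exists>P. h = (\<lambda>x. flat_fun P (c + x \<bullet> b))"
  then obtain P where h: "h = (\<lambda>x. flat_fun P (c + x \<bullet> b))" by blast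
  have "(h has_derivative (\<lambda>v. flat_fun (flat_pderiv P) (c + x \<bullet> b) * (v \<bullet> b))) (at x)" for x
    unfolding h
    using flat_fun_has_derivative[of P "c + x \<bullet> b", unfolded has_field_derivative_def]
    by (rule has_derivative_compose[rotated]) (auto intro!: derivative_eq_intros)
  moreover have "(\<lambda>x. flat_fun (flat_pderiv P) (c + x \<bullet> b) * (v \<bullet> b))
      = (\<lambda>x. flat_fun (smult (v \<bullet> b) (flat_pderiv P)) (c + x \<bullet> b))" for v
    by (auto simp: flat_fun_def)
  ultimately show "\<exists>D. \<forall>x. (h has_derivative D x) (at x) \<and>
      (\<forall>v. (\<exists>P. (\<lambda>x. D x v) = (\<lambda>x. flat_fun P (c + x \<bullet> b))) \<or> smooth_fun (\<lambda>x. D x v))"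
    by (intro exI[of _ "\<lambda>x v. flat_fun (flat_pderiv P) (c + x \<bullet> b) * (v \<bullet> b)"]) blast
qed auto

section \<open>Mollifiers\<close>

lemma continuous_compact_support_bounded:
  fixes f :: "'a::euclidean_space \<Rightarrow> real"
  assumes "continuous_on UNIV f" "compact K" "\<And>x. x \<notin> K \<Longrightarrow> f x = 0"
  shows "\<exists>B. \<forall>x. \<bar>f x\<bar> \<le> B"
proof -
  have "compact (f ` K)"
    using assms by (auto intro: compact_continuous_image continuous_on_subset)
  then obtain B where "\<And>y. y \<in> f ` K \<Longrightarrow> norm y \<le> B"
    by (meson bounded_iff compact_imp_bounded)
  then have "\<bar>f x\<bar> \<le> max B 0" for x
    using assms(3) by (cases "x \<in> K") (fastforce simp: le_max_iff_disj)+
  then show ?thesis by blast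
qed

lemma continuous_compact_support_integrable:
  fixes f :: "'a::euclidean_space \<Rightarrow> real"
  assumes "continuous_on UNIV f" "compact K" "\<And>x. x \<notin> K \<Longrightarrow> f x = 0"
  shows "integrable lborel f"
proof -
  have "integrable lborel (\<lambda>x. indicator K x *\<^sub>R f x)"
    using assms by (intro borel_integrable_compact) (auto intro: continuous_on_subset)
  moreover have "(\<lambda>x. indicator K x *\<^sub>R f x) = f"
    using assms(3) by (fastforce simp: indicator_def)
  ultimately show ?thesis by simp
qed

text \<open>The complement of the closed support is open, so vanishing there passes to the
  derivative. One \<open>K\<close> has to serve both, since \<open>weak_grad\<close> integrates
  against the function and against its derivative.\<close>

lemma test_fun_support:
  assumes "test_fun \<Omega> \<phi>"
  obtains K where "compact K" "K \<subseteq> \<Omega>" "\<And>x. x \<notin> K \<Longrightarrow> \<phi> x = 0"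
    "\<And>x v. x \<notin> K \<Longrightarrow> frechet_derivative \<phi> (at x) v = 0"
proof -
  define K where "K = closure {x. \<phi> x \<noteq> 0}"
  have K: "compact K" "K \<subseteq> \<Omega>" using assms by (auto simp: test_fun_def K_def)
  have 0: "\<phi> x = 0" if "x \<notin> K" for x
    using that closure_subset[of "{x. \<phi> x \<noteq> 0}"] unfolding K_def by blast
  have "frechet_derivative \<phi> (at x) v = 0" if "x \<notin> K" for x v
  proof -
    have "(\<phi> has_derivative (\<lambda>_. 0)) (at x)"
      by (rule has_derivative_transform_within_open[where f="\<lambda>_. 0" and s="- K"])
        (use that 0 K in \<open>auto intro: compact_imp_closed\<close>)
    from fun_cong[OF frechet_derivative_at[OF this], of v] show ?thesis by simp
  qed
  with K 0 that show thesis by blast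
qed

lemma test_fun_smooth: "test_fun \<Omega> \<phi> \<Longrightarrow> smooth_fun \<phi>"
  by (simp add: test_fun_def)

lemma test_funI:
  assumes "smooth_fun \<phi>" "compact K" "K \<subseteq> \<Omega>" "\<And>x. x \<notin> K \<Longrightarrow> \<phi> x = 0"
  shows "test_fun \<Omega> \<phi>"
proof -
  have "closure {x. \<phi> x \<noteq> 0} \<subseteq> K"
    using assms by (intro closure_minimal) (auto simp: compact_imp_closed)
  then show ?thesis
    using assms compact_Int_closed[OF assms(2), of "closure {x. \<phi> x \<noteq> 0}"]
    by (simp add: test_fun_def Int_absorb1)
qed

section \<open>A smooth mollifier of compact support\<close>

definition bump :: "real \<Rightarrow> 'a::euclidean_space \<Rightarrow> real" where
  "bump n z = (\<Prod>i\<in>Basis. flat_fun 1 (1 + n * (z \<bullet> i)) * flat_fun 1 (1 - n * (z \<bullet> i)))"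

definition mollifier :: "real \<Rightarrow> 'a::euclidean_space \<Rightarrow> real" where
  "mollifier n z = bump n z / (LINT w|lborel. bump n (w::'a))"

text \<open>Reflection swaps the two factors of each coordinate. Evenness later allows x - y and y -
  x to be exchanged under the integral.\<close>

lemma bump_minus: "bump n (- z) = bump n z"
  by (simp add: bump_def mult.commute)

lemma mollifier_minus: "mollifier n (- z) = mollifier n z"
  by (simp add: mollifier_def bump_minus)

lemma mollifier_commute: "mollifier n (x - y) = mollifier n (y - x)"
  using mollifier_minus[of n "x - y"] by simp

lemma bump_nonneg: "bump n z \<ge> 0"
  by (auto simp: bump_def flat_fun_def intro!: prod_nonneg)

lemma mollifier_nonneg: "mollifier n z \<ge> 0"
  by (simp add: mollifier_def bump_nonneg)

text \<open>Here the choice of a product over coordinates pays off: unlike a radial bump, it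
  involves \<open>flat_fun\<close> at affine arguments only, and these remain affine in y after the
  shift.\<close>

lemma smooth_fun_mollifier_shift: "smooth_fun (\<lambda>y::'a::euclidean_space. mollifier n (x - y))"
proof -
  have "smooth_fun (\<lambda>y. \<Prod>i\<in>Basis. flat_fun 1 ((1 + n * (x \<bullet> i)) + y \<bullet> (- n *\<^sub>R i))
      * flat_fun 1 ((1 - n * (x \<bullet> i)) + y \<bullet> (n *\<^sub>R i)))"
    by (intro smooth_fun_prod smooth_fun_mult smooth_fun_flat finite_Basis)
  from smooth_fun_mult[OF smooth_fun_const this, of "inverse (LINT w|lborel. bump n (w::'a))"]
  have "smooth_fun (\<lambda>y. inverse (LINT w|lborel. bump n (w::'a)) *
      (\<Prod>i\<in>Basis. flat_fun 1 ((1 + n * (x \<bullet> i)) + y \<bullet> (- n *\<^sub>R i))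
      * flat_fun 1 ((1 - n * (x \<bullet> i)) + y \<bullet> (n *\<^sub>R i))))" .
  moreover have "(1 + n * (x \<bullet> i)) + y \<bullet> (- n *\<^sub>R i) = 1 + n * ((x - y) \<bullet> i)"
    "(1 - n * (x \<bullet> i)) + y \<bullet> (n *\<^sub>R i) = 1 - n * ((x - y) \<bullet> i)" for i y
    by (simp_all add: inner_diff_left algebra_simps)
  ultimately have "smooth_fun (\<lambda>y. inverse (LINT w|lborel. bump n (w::'a)) * bump n (x - y))"
    by (simp only: bump_def)
  then show ?thesis
    by (simp only: mollifier_def divide_inverse mult.commute)
qed

lemma smooth_fun_mollifier: "smooth_fun (mollifier n)"
  using smooth_fun_mollifier_shift[of n 0] by (simp add: mollifier_minus)

text \<open>The bump lives on the cube of half side 1/n. Comparing the norm with the sum of the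
  absolute coordinates encloses the cube in a ball, which explains the radius DIM / n.\<close>

lemma bump_zero:
  fixes z :: "'a::euclidean_space"
  assumes "n > 0" "norm z > DIM('a) / n"
  shows "bump n z = 0"
proof -
  have "\<exists>i\<in>Basis. \<bar>z \<bullet> i\<bar> > 1 / n"
  proof (rule ccontr)
    assume "\<not> ?thesis"
    then have "(\<Sum>i\<in>Basis. \<bar>z \<bullet> i\<bar>) \<le> (\<Sum>i\<in>(Basis::'a set). 1 / n)"
      by (intro sum_mono) (auto simp: not_less)
    then show False using norm_le_l1[of z] assms by simp
  qed
  then obtain i where i: "i \<in> Basis" "\<bar>z \<bullet> i\<bar> > 1 / n" by blast
  then have "n * \<bar>z \<bullet> i\<bar> > 1" using assms by (simp add: field_simps)
  then have "flat_fun 1 (1 + n * (z \<bullet> i)) * flat_fun 1 (1 - n * (z \<bullet> i)) = 0"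
    by (auto simp: flat_fun_def abs_if split: if_splits)
  then show ?thesis using i(1) by (auto simp: bump_def intro!: prod_zero)
qed

lemma mollifier_zero:
  fixes z :: "'a::euclidean_space"
  assumes "n > 0" "norm z > DIM('a) / n"
  shows "mollifier n z = 0"
  using bump_zero[OF assms] by (simp add: mollifier_def)

lemma continuous_on_bump: "continuous_on A (bump n :: 'a::euclidean_space \<Rightarrow> real)"
proof -
  have "continuous_on UNIV (flat_fun 1)"
    by (meson DERIV_continuous continuous_at_imp_continuous_on flat_fun_has_derivative)
  then have c: "continuous_on A (\<lambda>z. flat_fun 1 (g z))" if "continuous_on A g" for g :: "'a \<Rightarrow> real"
    using that by (rule continuous_on_compose2) simp
  show ?thesis
    unfolding bump_def by (intro continuous_intros c)
qed

text \<open>The bump is continuous and positive at 0, hence positive on a nonempty open set, which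
  is not negligible.\<close>

lemma integral_bump_pos:
  assumes "n > 0"
  shows "(LINT z|lborel. bump n (z::'a::euclidean_space)) > 0"
proof -
  have int: "integrable lborel (bump n :: 'a \<Rightarrow> real)"
    by (rule continuous_compact_support_integrable[OF continuous_on_bump, of "cball 0 (DIM('a) / n)"])
      (use bump_zero[OF assms] in \<open>auto simp: not_le\<close>)
  have "bump n (0::'a) > 0"
    by (auto simp: bump_def flat_fun_def intro!: prod_pos)
  have "open {z::'a. bump n z > 0}"
    using continuous_on_bump[of UNIV n] by (auto intro!: open_Collect_less)
  have "(LINT z|lborel. bump n (z::'a)) \<noteq> 0"
  proof
    assume "(LINT z|lborel. bump n (z::'a)) = 0"
    then have "AE z in lborel. bump n (z::'a) = 0"
      using integral_nonneg_eq_0_iff_AE[OF int] by (auto simp: bump_nonneg)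
    then have "AE z in lborel. z \<notin> {z::'a. bump n z > 0}"
      by (rule eventually_mono) simp
    then have "{z::'a. bump n z > 0} \<in> null_sets lborel"
      using AE_iff_null_sets[of "{z::'a. bump n z > 0}" lborel] borel_open[OF \<open>open {z::'a. bump n z > 0}\<close>]
      by simp
    then have "negligible {z::'a. bump n z > 0}"
      by (simp add: negligible_iff_null_sets null_sets_completionI)
    then show False
      using open_not_negligible[OF \<open>open _\<close>] \<open>bump n (0::'a) > 0\<close> by auto
  qed
  moreover have "(LINT z|lborel. bump n (z::'a)) \<ge> 0"
    by (simp add: bump_nonneg)
  ultimately show ?thesis by linarith
qed

lemma continuous_on_mollifier: "continuous_on A (mollifier n)"
  by (simp add: smooth_fun_continuous smooth_fun_mollifier)

lemma mollifier_measurable [measurable]: "mollifier n \<in> borel_measurable borel"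
  by (simp add: borel_measurable_continuous_onI continuous_on_mollifier)

lemma mollifier_integrable: "n > 0 \<Longrightarrow> integrable lborel (mollifier n :: 'a::euclidean_space \<Rightarrow> real)"
  by (rule continuous_compact_support_integrable[OF continuous_on_mollifier, of "cball 0 (DIM('a) / n)"])
    (auto intro: mollifier_zero)

lemma integral_mollifier:
  "n > 0 \<Longrightarrow> (LINT z|lborel. mollifier n (z::'a::euclidean_space)) = 1"
  using integral_bump_pos[of n, where 'a='a] by (simp add: mollifier_def)

section \<open>Translation invariance and integration by parts on the whole space\<close>

lemma lborel_integral_translate:
  fixes f :: "'a::euclidean_space \<Rightarrow> real"
  assumes [measurable]: "f \<in> borel_measurable borel"
  shows "(LINT x|lborel. f (c + x)) = (LINT x|lborel. f x)"
proof -
  have "(LINT x|lborel. f x) = (LINT x|distr lborel borel ((+) c). f x)"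
    by (simp add: lborel_distr_plus)
  also have "\<dots> = (LINT x|lborel. f (c + x))"
    by (rule integral_distr) simp_all
  finally show ?thesis by simp
qed

lemma lborel_integrable_translate:
  fixes f :: "'a::euclidean_space \<Rightarrow> real"
  assumes f: "integrable lborel f"
  shows "integrable lborel (\<lambda>x. f (c + x))"
proof -
  have [measurable]: "f \<in> borel_measurable borel" using f by simp
  have "integrable (distr lborel borel ((+) c)) f"
    using f by (simp add: lborel_distr_plus)
  then show ?thesis
    by (subst (asm) integrable_distr_eq) simp_all
qed

lemma integral_mollifier_shift:
  fixes y :: "'a::euclidean_space"
  assumes "n > 0"
  shows "(LINT x|lborel. mollifier n (x - y)) = 1" "integrable lborel (\<lambda>x. mollifier n (x - y))"
    "(LINT x|lborel. mollifier n (y - x)) = 1" "integrable lborel (\<lambda>x. mollifier n (y - x))"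
proof -
  show 1: "(LINT x|lborel. mollifier n (x - y)) = 1"
    using lborel_integral_translate[of "mollifier n" "- y"] integral_mollifier[OF assms, where 'a='a] by simp
  show 2: "integrable lborel (\<lambda>x. mollifier n (x - y))"
    using lborel_integrable_translate[OF mollifier_integrable[OF assms], of "- y"] by simp
  show "(LINT x|lborel. mollifier n (y - x)) = 1" "integrable lborel (\<lambda>x. mollifier n (y - x))"
    using 1 2 by (simp_all add: mollifier_commute[of n y])
qed

text \<open>A derivative at parameter 0 for every base point is a derivative at every parameter of
  every line in direction v, so the mean value bound applies to the restriction of F to such a
  line.\<close>

lemma directional_lipschitz:
  fixes F :: "'a::real_normed_vector \<Rightarrow> real"
  assumes der: "\<And>x. ((\<lambda>t. F (x + t *\<^sub>R v)) has_real_derivative F' x) (at 0)"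
    and B: "\<And>x. \<bar>F' x\<bar> \<le> B"
  shows "\<bar>F (x + h *\<^sub>R v) - F x\<bar> \<le> B * \<bar>h\<bar>"
proof -
  have "((\<lambda>t. F (x + t *\<^sub>R v)) has_real_derivative F' (x + s *\<^sub>R v)) (at s)" for s
    using der[of "x + s *\<^sub>R v"] DERIV_shift[of "\<lambda>t. F (x + t *\<^sub>R v)" "F' (x + s *\<^sub>R v)" 0 s]
    by (simp add: algebra_simps)
  then have "norm (F (x + h *\<^sub>R v) - F (x + 0 *\<^sub>R v)) \<le> B * norm (h - 0)"
    using B by (intro field_differentiable_bound[of UNIV "\<lambda>t. F (x + t *\<^sub>R v)" "\<lambda>s. F' (x + s *\<^sub>R v)" B h 0])
      (auto intro: DERIV_subset)
  then show ?thesis by simp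
qed

text \<open>This is integration by parts without iterated integrals. Translation invariance makes
  the integral of each difference quotient 0, and dominated convergence carries this over to the
  derivative.\<close>

lemma integral_directional_derivative_eq_0:
  fixes F F' :: "'a::euclidean_space \<Rightarrow> real"
  assumes der: "\<And>x. ((\<lambda>t. F (x + t *\<^sub>R v)) has_real_derivative F' x) (at 0)"
    and B: "\<And>x. \<bar>F' x\<bar> \<le> B"
    and int: "integrable lborel F" and K: "compact K" "\<And>x. x \<notin> K \<Longrightarrow> F x = 0"
  shows "(LINT x|lborel. F' x) = 0"
proof -
  define h where "h m = inverse (real (Suc m))" for m
  define q where "q m x = (F (h m *\<^sub>R v + x) - F x) / h m" for m x
  \<comment> \<open>Since h m \<le> 1, every difference quotient vanishes off this enlargement of K;
    B times its indicator is the dominating function.\<close>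
  define L where "L = {x + y |x y. x \<in> K \<and> y \<in> cball 0 (norm v)}"
  have h: "0 < h m" "h m \<le> 1" for m by (auto simp: h_def field_simps)
  have h0: "h \<longlonglongrightarrow> 0" unfolding h_def by (rule LIMSEQ_inverse_real_of_nat)
  have "compact L" unfolding L_def by (intro compact_sums K) simp
  have [measurable]: "F \<in> borel_measurable borel" using int by simp
  have qF: "(\<lambda>m. q m x) \<longlonglongrightarrow> F' x" for x
  proof -
    have "((\<lambda>t. (F (x + t *\<^sub>R v) - F x) / t) \<longlongrightarrow> F' x) (at 0)"
      using der[of x] by (simp add: DERIV_def)
    moreover have "filterlim h (at 0) sequentially"
      using h0 h(1) by (auto simp: filterlim_at intro!: always_eventually) (metis less_irrefl)
    ultimately have "(\<lambda>m. (F (x + h m *\<^sub>R v) - F x) / h m) \<longlonglongrightarrow> F' x"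
      by (rule filterlim_compose)
    then show ?thesis by (simp add: q_def add.commute)
  qed
  have [measurable]: "q m \<in> borel_measurable borel" for m
    unfolding q_def by measurable
  \<comment> \<open>F' is known only pointwise; it is measurable as a limit of difference
    quotients.\<close>
  have [measurable]: "F' \<in> borel_measurable borel"
    by (rule borel_measurable_LIMSEQ_real[where u=q]) (use qF in auto)
  have qB: "\<bar>q m x\<bar> \<le> B * indicator L x" for m x
  proof (cases "x \<in> L")
    case True
    have "\<bar>F (x + h m *\<^sub>R v) - F x\<bar> \<le> B * \<bar>h m\<bar>"
      by (rule directional_lipschitz[OF der B])
    then show ?thesis
      using h(1)[of m] True by (simp add: q_def abs_divide field_simps)
  next
    case False
    have "x \<notin> K"
    proof
      assume "x \<in> K"
      then have "x + 0 \<in> L" unfolding L_def by fastforce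
      then show False using False by simp
    qed
    moreover have "h m *\<^sub>R v + x \<notin> K"
    proof
      assume "h m *\<^sub>R v + x \<in> K"
      moreover have "- (h m *\<^sub>R v) \<in> cball 0 (norm v)"
        using h[of m] mult_right_mono[of "h m" 1 "norm v"] by simp
      ultimately have "(h m *\<^sub>R v + x) + - (h m *\<^sub>R v) \<in> L" unfolding L_def by blast
      then show False using False by simp
    qed
    ultimately show ?thesis using K(2) False by (simp add: q_def)
  qed
  have "(\<lambda>m. LINT x|lborel. q m x) \<longlonglongrightarrow> (LINT x|lborel. F' x)"
  proof (rule integral_dominated_convergence)
    show "integrable lborel (\<lambda>x. B * indicator L x)"
      using \<open>compact L\<close> emeasure_compact_finite[OF \<open>compact L\<close>]
      by (intro integrable_mult_right integrable_real_indicator) (auto simp: compact_imp_closed)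
  qed (use qF qB in auto)
  moreover have "(LINT x|lborel. q m x) = 0" for m
    unfolding q_def
    using lborel_integral_translate[of F "h m *\<^sub>R v"] lborel_integrable_translate[OF int, of "h m *\<^sub>R v"] int
    by simp
  ultimately show ?thesis by (simp add: LIMSEQ_const_iff)
qed

section \<open>Convolution with the mollifier and its convergence in L^1\<close>

definition mollify :: "real \<Rightarrow> ('a::euclidean_space \<Rightarrow> real) \<Rightarrow> 'a \<Rightarrow> real" where
  "mollify n f x = (LINT y|lborel. f y * mollifier n (x - y))"

lemma mollifier_bounded: "n > 0 \<Longrightarrow> \<exists>B. \<forall>z::'a::euclidean_space. \<bar>mollifier n z\<bar> \<le> B"
  by (rule continuous_compact_support_bounded[OF continuous_on_mollifier, of "cball 0 (DIM('a) / n)"])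
    (auto intro: mollifier_zero)

lemma abs_integral_le:
  fixes f g :: "'a \<Rightarrow> real"
  assumes "integrable M f" "integrable M g" "\<And>x. \<bar>f x\<bar> \<le> g x"
  shows "\<bar>LINT x|M. f x\<bar> \<le> (LINT x|M. g x)"
proof -
  have "\<bar>LINT x|M. f x\<bar> \<le> (LINT x|M. \<bar>f x\<bar>)"
    using integral_norm_bound[of M f] by simp
  also have "\<dots> \<le> (LINT x|M. g x)"
    using assms by (intro integral_mono) auto
  finally show ?thesis .
qed

lemma integrable_mult_bounded:
  fixes f g :: "'a \<Rightarrow> real"
  assumes f: "integrable M f" and g: "g \<in> borel_measurable M" and B: "\<And>x. \<bar>g x\<bar> \<le> B"
  shows "integrable M (\<lambda>x. f x * g x)" "\<bar>LINT x|M. f x * g x\<bar> \<le> B * (LINT x|M. \<bar>f x\<bar>)"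
proof -
  have le: "\<bar>f x * g x\<bar> \<le> B * \<bar>f x\<bar>" for x
    using mult_left_mono[OF B, of "\<bar>f x\<bar>" x] by (simp add: abs_mult mult.commute)
  show 1: "integrable M (\<lambda>x. f x * g x)"
  proof (rule Bochner_Integration.integrable_bound[of M "\<lambda>x. B * \<bar>f x\<bar>"])
    show "AE x in M. norm (f x * g x) \<le> norm (B * \<bar>f x\<bar>)"
      by (rule AE_I2) (use le in \<open>metis abs_ge_self order_trans real_norm_def\<close>)
  qed (use f g in auto)
  have "\<bar>LINT x|M. f x * g x\<bar> \<le> (LINT x|M. B * \<bar>f x\<bar>)"
    using 1 f le by (intro abs_integral_le) auto
  then show "\<bar>LINT x|M. f x * g x\<bar> \<le> B * (LINT x|M. \<bar>f x\<bar>)" by simp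
qed

lemma mollify_integrand:
  assumes "n > 0" "integrable lborel f"
  shows "integrable lborel (\<lambda>y. f y * mollifier n (x - y))"
proof -
  obtain B where "\<And>z::'a. \<bar>mollifier n z\<bar> \<le> B" using mollifier_bounded[OF assms(1)] by blast
  then show ?thesis using assms(2) by (intro integrable_mult_bounded[of _ _ _ B]) auto
qed

lemma mollify_measurable [measurable]:
  assumes [measurable]: "f \<in> borel_measurable borel"
  shows "mollify n f \<in> borel_measurable borel"
  unfolding mollify_def by measurable

lemma mollify_bounded:
  fixes f :: "'a::euclidean_space \<Rightarrow> real"
  assumes "n > 0" "integrable lborel f"
  shows "\<exists>B. \<forall>x. \<bar>mollify n f x\<bar> \<le> B"
proof -
  obtain B where "\<And>z::'a. \<bar>mollifier n z\<bar> \<le> B" using mollifier_bounded[OF assms(1)] by blast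
  then have "\<bar>mollify n f x\<bar> \<le> B * (LINT y|lborel. \<bar>f y\<bar>)" for x
    unfolding mollify_def using assms(2) by (intro integrable_mult_bounded(2)) auto
  then show ?thesis by blast
qed

lemma mollify_diff:
  assumes "n > 0" "integrable lborel f" "integrable lborel g"
  shows "mollify n (\<lambda>x. f x - g x) x = mollify n f x - mollify n g x"
  using mollify_integrand[OF assms(1,2)] mollify_integrand[OF assms(1,3)]
  by (simp add: mollify_def left_diff_distrib)

text \<open>Both claims come from one use of Fubini for f(y) times the kernel at x - y: the kernel
  has mass 1 in x, so the inner integral of the absolute value is |f y|.\<close>

lemma
  fixes f :: "'a::euclidean_space \<Rightarrow> real"
  assumes n: "n > 0" and f: "integrable lborel f"
  shows mollify_integrable: "integrable lborel (mollify n f)"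
    and integral_mollify: "(LINT x|lborel. mollify n f x) = (LINT x|lborel. f x)"
proof -
  have [measurable]: "f \<in> borel_measurable borel" using f by simp
  let ?F = "\<lambda>y x. f y * mollifier n (x - y)"
  have "integrable (lborel \<Otimes>\<^sub>M lborel) (case_prod ?F)"
  proof (rule lborel_pair.Fubini_integrable)
    have "(LINT x|lborel. norm (?F y x)) = \<bar>f y\<bar>" for y
      using integral_mollifier_shift[OF n, of y] by (simp add: abs_mult mollifier_nonneg)
    then show "integrable lborel (\<lambda>y. LINT x|lborel. norm (case (y, x) of (y, x) \<Rightarrow> ?F y x))"
      using f by simp
    show "AE y in lborel. integrable lborel (\<lambda>x. case (y, x) of (y, x) \<Rightarrow> ?F y x)"
      by (intro AE_I2) (simp add: integral_mollifier_shift(2)[OF n])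
  qed measurable
  note * = lborel_pair.integrable_snd[OF this] lborel_pair.integral_snd[OF this] lborel_pair.integral_fst[OF this]
  show "integrable lborel (mollify n f)"
    using *(1) by (simp add: mollify_def[abs_def])
  show "(LINT x|lborel. mollify n f x) = (LINT x|lborel. f x)"
    using trans[OF *(2) *(3)[symmetric]] by (simp add: mollify_def[abs_def] integral_mollifier_shift(1)[OF n])
qed

text \<open>The bound does not depend on n, which reduces L^1 convergence to a dense class of
  functions.\<close>

lemma mollify_L1_contraction:
  assumes n: "n > 0" and f: "integrable lborel f"
  shows "(LINT x|lborel. \<bar>mollify n f x\<bar>) \<le> (LINT x|lborel. \<bar>f x\<bar>)"
proof -
  have "\<bar>mollify n f x\<bar> \<le> mollify n (\<lambda>y. \<bar>f y\<bar>) x" for x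
    unfolding mollify_def
    using integral_norm_bound[of lborel "\<lambda>y. f y * mollifier n (x - y)"]
    by (simp add: abs_mult mollifier_nonneg)
  then have "(LINT x|lborel. \<bar>mollify n f x\<bar>) \<le> (LINT x|lborel. mollify n (\<lambda>y. \<bar>f y\<bar>) x)"
    using f n by (intro integral_mono mollify_integrable integrable_abs) auto
  then show ?thesis using f n by (simp add: integral_mollify)
qed

text \<open>By induction on integrable functions. The case with content is an indicator, where
  Urysohn's lemma interpolates between an inner closed and an outer open approximation of the set;
  sums and dominated limits follow by splitting e.\<close>

lemma integrable_approx_continuous:
  fixes f :: "'a::euclidean_space \<Rightarrow> real"
  assumes "integrable lborel f" "e > 0"
  shows "\<exists>g. continuous_on UNIV g \<and> integrable lborel g \<and> (LINT x|lborel. \<bar>f x - g x\<bar>) < e"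
  using assms
proof (induction arbitrary: e)
  case (base A c)
  \<comment> \<open>The error will be below 2 d |c|, which this choice keeps under e; the added 1
    covers c = 0.\<close>
  define d where "d = e / (2 * (\<bar>c\<bar> + 1))"
  have d: "d > 0" using base.prems by (simp add: d_def)
  have A: "A \<in> sets lebesgue" using base.hyps by simp
  obtain T where T: "open T" "A \<subseteq> T" "T - A \<in> lmeasurable" "emeasure lebesgue (T - A) < ennreal d"
    using sets_lebesgue_outer_open[OF A d] by blast
  obtain S where S: "closed S" "S \<subseteq> A" "A - S \<in> lmeasurable" "emeasure lebesgue (A - S) < ennreal d"
    using sets_lebesgue_inner_closed[OF A d] by blast
  have "S \<inter> - T = {}" "closed (- T)" using S(2) T by auto
  then obtain h :: "'a \<Rightarrow> real" where h: "continuous_on UNIV h" "\<And>x. h x \<in> closed_segment 0 1"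
    "\<And>x. x \<in> S \<Longrightarrow> h x = 1" "\<And>x. x \<in> - T \<Longrightarrow> h x = 0"
    using Urysohn[of "- T" S 0 1] \<open>closed S\<close> by (metis Int_commute)
  have h01: "0 \<le> h x" "h x \<le> 1" for x using h(2)[of x] by (auto simp: closed_segment_eq_real_ivl)
  have [measurable]: "h \<in> borel_measurable borel" "A \<in> sets borel" "T \<in> sets borel" "S \<in> sets borel"
    using h(1) base.hyps T S by (auto intro: borel_measurable_continuous_onI)
  have em: "emeasure lborel (T - A) < ennreal d" "emeasure lborel (A - S) < ennreal d"
    using T(4) S(4) by (simp_all add: emeasure_completion)
  have iT: "integrable lborel (indicator (T - A) :: 'a \<Rightarrow> real)"
    "integrable lborel (indicator (A - S) :: 'a \<Rightarrow> real)" "integrable lborel (indicator A :: 'a \<Rightarrow> real)"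
    using em base.hyps by (auto intro!: integrable_real_indicator elim: order.strict_trans)
  \<comment> \<open>h is 1 on S and 0 off T, so it can differ from the indicator of A only on T - A
    and A - S, where the difference is at most 1.\<close>
  have le: "\<bar>indicator A x - h x\<bar> \<le> indicator (T - A) x + indicator (A - S) x" for x
    using h01[of x] h(3,4)[of x] T(2) S(2) by (auto simp: indicator_def)
  have i: "integrable lborel (\<lambda>x. indicator A x - h x)"
    by (rule Bochner_Integration.integrable_bound[of _ "\<lambda>x. indicator (T - A) x + indicator (A - S) x :: real"])
      (use iT le in auto)
  have ih: "integrable lborel h"
    using Bochner_Integration.integrable_diff[OF iT(3) i] by simp
  have "(LINT x|lborel. \<bar>indicator A x - h x\<bar>) \<le> (LINT x|lborel. indicator (T - A) x + indicator (A - S) x)"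
    using i iT le by (intro integral_mono) auto
  also have "\<dots> = measure lborel (T - A) + measure lborel (A - S)"
    using iT by simp
  also have "\<dots> < 2 * d"
    using em d by (simp add: measure_def) (smt (verit) enn2real_less_iff enn2real_positive_iff ennreal_less_top order.strict_trans)
  finally have *: "(LINT x|lborel. \<bar>indicator A x - h x\<bar>) < 2 * d" .
  have "(LINT x|lborel. \<bar>indicator A x *\<^sub>R c - h x * c\<bar>) = (LINT x|lborel. \<bar>indicator A x - h x\<bar>) * \<bar>c\<bar>"
    by (simp add: abs_mult flip: left_diff_distrib)
  also have "\<dots> \<le> 2 * d * \<bar>c\<bar>" using * by (intro mult_right_mono) auto
  also have "\<dots> < e" using base.prems by (simp add: d_def field_simps)
  finally show ?case
    using h(1) ih by (intro exI[of _ "\<lambda>x. h x * c"]) (auto intro!: continuous_intros)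
next
  case (add f g)
  obtain f' where f': "continuous_on UNIV f'" "integrable lborel f'" "(LINT x|lborel. \<bar>f x - f' x\<bar>) < e / 2"
    using add.IH(1)[of "e / 2"] add.prems by auto
  obtain g' where g': "continuous_on UNIV g'" "integrable lborel g'" "(LINT x|lborel. \<bar>g x - g' x\<bar>) < e / 2"
    using add.IH(2)[of "e / 2"] add.prems by auto
  have "(LINT x|lborel. \<bar>(f x + g x) - (f' x + g' x)\<bar>) \<le> (LINT x|lborel. \<bar>f x - f' x\<bar> + \<bar>g x - g' x\<bar>)"
    using add.hyps f' g' by (intro integral_mono) auto
  also have "\<dots> < e" using add.hyps f' g' by simp
  finally show ?case
    using f' g' by (intro exI[of _ "\<lambda>x. f' x + g' x"]) (auto intro!: continuous_intros)
next
  case (lim f s)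
  have "(\<lambda>i. LINT x|lborel. \<bar>s i x - f x\<bar>) \<longlonglongrightarrow> (LINT x|lborel. \<bar>f x - f x\<bar>)"
  \<comment> \<open>The induction supplies |s i| \<le> 2 |f|, and subtracting f adds one more
    |f|.\<close>
  proof (rule integral_dominated_convergence[where w="\<lambda>x. 3 * \<bar>f x\<bar>"])
    show "AE x in lborel. (\<lambda>i. \<bar>s i x - f x\<bar>) \<longlonglongrightarrow> \<bar>f x - f x\<bar>"
      using lim.hyps(2) by (intro AE_I2 tendsto_intros) auto
    show "AE x in lborel. norm \<bar>s i x - f x\<bar> \<le> 3 * \<bar>f x\<bar>" for i
    proof (rule AE_I2)
      fix x
      show "norm \<bar>s i x - f x\<bar> \<le> 3 * \<bar>f x\<bar>"
        using lim.hyps(3)[of x i] abs_triangle_ineq4[of "s i x" "f x"] by simp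
    qed
  qed (use lim.hyps in auto)
  then have "(\<lambda>i. LINT x|lborel. \<bar>s i x - f x\<bar>) \<longlonglongrightarrow> 0" by simp
  then have "\<forall>\<^sub>F i in sequentially. (LINT x|lborel. \<bar>s i x - f x\<bar>) < e / 2"
    using lim.prems by (intro order_tendstoD) auto
  then obtain i where i: "(LINT x|lborel. \<bar>s i x - f x\<bar>) < e / 2"
    using eventually_happens by force
  obtain g where g: "continuous_on UNIV g" "integrable lborel g" "(LINT x|lborel. \<bar>s i x - g x\<bar>) < e / 2"
    using lim.IH[of "e / 2" i] lim.prems by auto
  have "(LINT x|lborel. \<bar>f x - g x\<bar>) \<le> (LINT x|lborel. \<bar>s i x - f x\<bar> + \<bar>s i x - g x\<bar>)"
    using lim.hyps g by (intro integral_mono) auto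
  also have "\<dots> < e" using lim.hyps g i by simp
  finally show ?case using g by blast
qed

text \<open>The kernel averages g over a ball whose radius tends to 0, and g is uniformly continuous
  near C. Indices are shifted to \<open>Suc m\<close> to keep the mollification parameter
  positive.\<close>

lemma mollify_uniform_on_compact:
  fixes g :: "'a::euclidean_space \<Rightarrow> real"
  assumes g: "continuous_on UNIV g" "integrable lborel g" and C: "compact C" and e: "e > 0"
  shows "\<forall>\<^sub>F m in sequentially. \<forall>x\<in>C. \<bar>mollify (real (Suc m)) g x - g x\<bar> \<le> e"
proof -
  \<comment> \<open>Once DIM / Suc m is below 1, the kernel centred at a point of C sees only this
    enlargement.\<close>
  define L where "L = {x + y |x y. x \<in> C \<and> y \<in> cball (0::'a) 1}"
  have "compact L" unfolding L_def using C by (intro compact_sums) auto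
  then have "uniformly_continuous_on L g"
    using g(1) by (intro compact_uniformly_continuous) (auto intro: continuous_on_subset)
  then obtain d where d: "d > 0" "\<And>x y. x \<in> L \<Longrightarrow> y \<in> L \<Longrightarrow> dist y x < d \<Longrightarrow> dist (g y) (g x) < e"
    using e unfolding uniformly_continuous_on_def by blast
  have "(\<lambda>m. DIM('a) * inverse (real (Suc m))) \<longlonglongrightarrow> real DIM('a) * 0"
    by (intro tendsto_intros LIMSEQ_inverse_real_of_nat)
  then have "\<forall>\<^sub>F m in sequentially. DIM('a) * inverse (real (Suc m)) < min d 1"
    using d(1) by (intro order_tendstoD) auto
  then show ?thesis
  proof (rule eventually_mono, intro ballI)
    fix m x assume m: "DIM('a) * inverse (real (Suc m)) < min d 1" and x: "x \<in> C"
    let ?n = "real (Suc m)"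
    have n: "?n > 0" by simp
    have xL: "x \<in> L" unfolding L_def using x by (force intro: exI[of _ x])
    have le: "\<bar>(g y - g x) * mollifier ?n (x - y)\<bar> \<le> e * mollifier ?n (x - y)" for y
    proof (cases "norm (x - y) > DIM('a) / ?n")
      case True
      then show ?thesis using mollifier_zero[OF n True] by simp
    next
      case False
      then have "norm (x - y) < min d 1" using m by (simp add: divide_inverse)
      moreover from this have "y = x + (y - x) \<and> x \<in> C \<and> y - x \<in> cball 0 1"
        using x by (simp add: norm_minus_commute)
      then have "y \<in> L" unfolding L_def by blast
      ultimately have "\<bar>g y - g x\<bar> \<le> e"
        using d(2)[OF xL, of y] by (simp add: dist_norm norm_minus_commute less_imp_le)
      then show ?thesis by (simp add: abs_mult mollifier_nonneg mult_right_mono)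
    qed
    have i: "integrable lborel (\<lambda>y. (g y - g x) * mollifier ?n (x - y))"
      using mollify_integrand[OF n g(2), of x] integral_mollifier_shift(4)[OF n, of x]
      by (simp add: left_diff_distrib)
    \<comment> \<open>The kernel has mass 1, so g x is itself the average of the constant g
      x.\<close>
    have "mollify ?n g x - g x = (LINT y|lborel. (g y - g x) * mollifier ?n (x - y))"
      using mollify_integrand[OF n g(2), of x] integral_mollifier_shift(3,4)[OF n, of x]
      by (simp add: mollify_def left_diff_distrib)
    also have "\<bar>\<dots>\<bar> \<le> (LINT y|lborel. e * mollifier ?n (x - y))"
      using i le integral_mollifier_shift(4)[OF n, of x] by (intro abs_integral_le) auto
    also have "\<dots> = e" using integral_mollifier_shift(3)[OF n, of x] by simp
    finally show "\<bar>mollify ?n g x - g x\<bar> \<le> e" .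
  qed
qed

lemma integrable_indicator_mult:
  fixes f :: "'a::euclidean_space \<Rightarrow> real"
  assumes "compact C" "integrable lborel f"
  shows "integrable lborel (\<lambda>x. indicator C x * f x)"
  using integrable_real_mult_indicator[OF _ assms(2), of C] assms(1)
  by (simp add: compact_imp_closed mult.commute)

text \<open>A continuous g close to f splits the error in three: contraction handles the mollified f
  - g, the choice of g handles f - g, and uniform convergence handles g. The last of these ties the
  statement to a compact C.\<close>

lemma mollify_tendsto_L1:
  fixes f :: "'a::euclidean_space \<Rightarrow> real"
  assumes f: "integrable lborel f" and C: "compact C"
  shows "(\<lambda>m. LINT x|lborel. indicator C x * \<bar>mollify (real (Suc m)) f x - f x\<bar>) \<longlonglongrightarrow> 0"
proof (rule LIMSEQ_I)
  fix e :: real assume e: "e > 0"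
  obtain g where g: "continuous_on UNIV g" "integrable lborel g" "(LINT x|lborel. \<bar>f x - g x\<bar>) < e / 4"
    using integrable_approx_continuous[OF f, of "e / 4"] e by auto
  \<comment> \<open>Each of the three errors is at most e/4; the added 1 keeps the quotient
    meaningful when C is a null set.\<close>
  define d where "d = e / 4 / (measure lborel C + 1)"
  have M: "measure lborel C + 1 > 0" by (rule add_nonneg_pos) simp_all
  with e have d: "d > 0" unfolding d_def by simp
  have "d * measure lborel C \<le> d * (measure lborel C + 1)" using d by simp
  also have "\<dots> = e / 4" using M unfolding d_def by (metis less_irrefl nonzero_divide_eq_eq)
  finally have d: "d > 0" "d * measure lborel C \<le> e / 4" using d by auto
  have "\<forall>\<^sub>F m in sequentially. \<bar>LINT x|lborel. indicator C x * \<bar>mollify (real (Suc m)) f x - f x\<bar>\<bar> < e"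
    using mollify_uniform_on_compact[OF g(1,2) C d(1)]
  proof (rule eventually_mono)
    fix m assume m: "\<forall>x\<in>C. \<bar>mollify (real (Suc m)) g x - g x\<bar> \<le> d"
    let ?n = "real (Suc m)"
    have n: "?n > 0" by simp
    note i = mollify_integrable[OF n f] mollify_integrable[OF n g(2)] f g(2)
      mollify_integrable[OF n Bochner_Integration.integrable_diff[OF f g(2)]]
    have iC: "integrable lborel (\<lambda>x. d * indicator C x)"
      using C emeasure_compact_finite[OF C]
      by (intro integrable_mult_right integrable_real_indicator) (auto simp: compact_imp_closed)
    have "indicator C x * \<bar>mollify ?n f x - f x\<bar>
        \<le> \<bar>mollify ?n (\<lambda>x. f x - g x) x\<bar> + \<bar>f x - g x\<bar> + d * indicator C x" for x
    proof (cases "x \<in> C")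
      case True
      have "\<bar>mollify ?n f x - f x\<bar> \<le> \<bar>mollify ?n f x - mollify ?n g x\<bar> + \<bar>f x - g x\<bar> + d"
        using m True by fastforce
      then show ?thesis using True unfolding mollify_diff[OF n f g(2)] by simp
    qed simp
    then have "(LINT x|lborel. indicator C x * \<bar>mollify ?n f x - f x\<bar>)
        \<le> (LINT x|lborel. \<bar>mollify ?n (\<lambda>x. f x - g x) x\<bar> + \<bar>f x - g x\<bar> + d * indicator C x)"
      using i C iC by (intro integral_mono integrable_indicator_mult) auto
    also have "\<dots> = (LINT x|lborel. \<bar>mollify ?n (\<lambda>x. f x - g x) x\<bar>) + (LINT x|lborel. \<bar>f x - g x\<bar>)
        + d * measure lborel C"
      using i iC by simp
    also have "\<dots> \<le> (LINT x|lborel. \<bar>f x - g x\<bar>) + (LINT x|lborel. \<bar>f x - g x\<bar>)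
        + d * measure lborel C"
      using f g by (intro add_right_mono mollify_L1_contraction n) auto
    finally have "(LINT x|lborel. indicator C x * \<bar>mollify ?n f x - f x\<bar>) < e"
      using g(3) d(2) e by linarith
    moreover have "(LINT x|lborel. indicator C x * \<bar>mollify ?n f x - f x\<bar>) \<ge> 0" by simp
    ultimately show "\<bar>LINT x|lborel. indicator C x * \<bar>mollify ?n f x - f x\<bar>\<bar> < e" by simp
  qed
  then show "\<exists>no. \<forall>m\<ge>no. norm ((LINT x|lborel. indicator C x * \<bar>mollify (real (Suc m)) f x - f x\<bar>) - 0) < e"
    by (simp add: eventually_sequentially)
qed

text \<open>The derivative falls on the kernel, whose difference quotients are uniformly bounded by
  the Lipschitz estimate. The second claim provides the bound that
  \<open>integral_directional_derivative_eq_0\<close> asks for.\<close>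

lemma mollify_has_directional_derivative:
  fixes f :: "'a::euclidean_space \<Rightarrow> real"
  assumes n: "n > 0" and f: "integrable lborel f"
  shows "((\<lambda>t. mollify n f (x + t *\<^sub>R v)) has_real_derivative
     (LINT y|lborel. f y * frechet_derivative (mollifier n) (at (x - y)) v)) (at 0)"
    and "\<exists>B. \<forall>x. \<bar>LINT y|lborel. f y * frechet_derivative (mollifier n) (at (x - y)) v\<bar> \<le> B"
proof -
  define D where "D z = frechet_derivative (mollifier n) (at (z::'a)) v" for z
  have Dsm: "smooth_fun D" unfolding D_def[abs_def]
    by (intro smooth_fun_derivative smooth_fun_mollifier)
  have "test_fun UNIV (mollifier n :: 'a \<Rightarrow> real)"
    by (rule test_funI[OF smooth_fun_mollifier, of "cball 0 (DIM('a) / n)"])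
      (auto intro: mollifier_zero[OF n])
  then obtain K where K: "compact K" "\<And>z. z \<notin> K \<Longrightarrow> D z = 0"
    unfolding D_def by (rule test_fun_support) blast
  obtain B where B: "\<And>z. \<bar>D z\<bar> \<le> B"
    using continuous_compact_support_bounded[OF smooth_fun_continuous[OF Dsm] K] by blast
  have [measurable]: "D \<in> borel_measurable borel"
    using Dsm by (simp add: borel_measurable_continuous_onI smooth_fun_continuous)
  have [measurable]: "f \<in> borel_measurable borel" using f by simp
  have der: "((\<lambda>t. mollifier n (z + t *\<^sub>R v)) has_real_derivative D z) (at 0)" for z :: 'a
    unfolding D_def by (rule smooth_fun_directional_derivative[OF smooth_fun_mollifier])
  have "((\<lambda>h. (mollify n f (x + h *\<^sub>R v) - mollify n f x) / h) \<longlongrightarrow> (LINT y|lborel. f y * D (x - y))) (at 0)"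
    \<comment> \<open>Dominated convergence concerns sequences, so the limit at 0 is tested along
      every null sequence X.\<close>
    unfolding tendsto_at_iff_sequentially o_def
  proof (intro allI impI)
    fix X :: "nat \<Rightarrow> real" assume X: "\<forall>i. X i \<in> UNIV - {0}" "X \<longlonglongrightarrow> 0"
    have eq: "(mollify n f (x + X i *\<^sub>R v) - mollify n f x) / X i
        = (LINT y|lborel. f y * ((mollifier n (x - y + X i *\<^sub>R v) - mollifier n (x - y)) / X i))" for i
    proof -
      have "mollify n f (x + X i *\<^sub>R v) - mollify n f x
          = (LINT y|lborel. f y * mollifier n (x + X i *\<^sub>R v - y) - f y * mollifier n (x - y))"
        unfolding mollify_def using mollify_integrand[OF n f] by simp
      also have "\<dots> / X i = (LINT y|lborel. (f y * mollifier n (x + X i *\<^sub>R v - y) - f y * mollifier n (x - y)) / X i)"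
        by simp
      also have "\<dots> = (LINT y|lborel. f y * ((mollifier n (x - y + X i *\<^sub>R v) - mollifier n (x - y)) / X i))"
        by (intro Bochner_Integration.integral_cong) (simp_all add: right_diff_distrib' algebra_simps)
      finally show ?thesis .
    qed
    have "(\<lambda>i. LINT y|lborel. f y * ((mollifier n (x - y + X i *\<^sub>R v) - mollifier n (x - y)) / X i))
        \<longlonglongrightarrow> (LINT y|lborel. f y * D (x - y))"
    proof (rule integral_dominated_convergence[where w="\<lambda>y. \<bar>f y\<bar> * B"])
      show "AE y in lborel. (\<lambda>i. f y * ((mollifier n (x - y + X i *\<^sub>R v) - mollifier n (x - y)) / X i))
          \<longlonglongrightarrow> f y * D (x - y)"
      proof (intro AE_I2 tendsto_intros)
        fix y
        have "((\<lambda>h. (mollifier n (x - y + h *\<^sub>R v) - mollifier n (x - y)) / h) \<longlongrightarrow> D (x - y)) (at 0)"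
          using der[of "x - y"] by (simp add: DERIV_def)
        then show "(\<lambda>i. (mollifier n (x - y + X i *\<^sub>R v) - mollifier n (x - y)) / X i) \<longlonglongrightarrow> D (x - y)"
          unfolding tendsto_at_iff_sequentially o_def using X by blast
      qed
      show "AE y in lborel. norm (f y * ((mollifier n (x - y + X i *\<^sub>R v) - mollifier n (x - y)) / X i)) \<le> \<bar>f y\<bar> * B" for i
      proof (rule AE_I2)
        fix y
        have "\<bar>mollifier n (x - y + X i *\<^sub>R v) - mollifier n (x - y)\<bar> \<le> B * \<bar>X i\<bar>"
          by (rule directional_lipschitz[OF der B])
        then have "\<bar>(mollifier n (x - y + X i *\<^sub>R v) - mollifier n (x - y)) / X i\<bar> \<le> B"
          using X(1) by (simp add: abs_divide divide_le_eq)
        then show "norm (f y * ((mollifier n (x - y + X i *\<^sub>R v) - mollifier n (x - y)) / X i)) \<le> \<bar>f y\<bar> * B"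
          by (simp only: real_norm_def abs_mult) (rule mult_left_mono, simp_all)
      qed
    qed (use f in auto)
    then show "(\<lambda>i. (mollify n f (x + X i *\<^sub>R v) - mollify n f x) / X i) \<longlonglongrightarrow> (LINT y|lborel. f y * D (x - y))"
      by (simp only: eq)
  qed
  then show "((\<lambda>t. mollify n f (x + t *\<^sub>R v)) has_real_derivative
     (LINT y|lborel. f y * frechet_derivative (mollifier n) (at (x - y)) v)) (at 0)"
    by (simp add: DERIV_def D_def)
  have "\<bar>LINT y|lborel. f y * D (x - y)\<bar> \<le> B * (LINT y|lborel. \<bar>f y\<bar>)" for x
    using f B by (intro integrable_mult_bounded(2)) auto
  then show "\<exists>B. \<forall>x. \<bar>LINT y|lborel. f y * frechet_derivative (mollifier n) (at (x - y)) v\<bar> \<le> B"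
    unfolding D_def by blast
qed

section \<open>Weak gradients\<close>

text \<open>Cutting u off outside K and passing to a Borel version yields a function on the whole
  space to which the \<open>lborel\<close> results on mollification apply.\<close>

lemma ex_borel_representative:
  fixes u :: "'a::euclidean_space \<Rightarrow> real"
  assumes "compact K" "set_integrable lebesgue K u"
  shows "\<exists>v. integrable lborel v \<and> (AE x in lborel. x \<in> K \<longrightarrow> v x = u x)"
proof -
  have int: "integrable lebesgue (\<lambda>x. indicator K x *\<^sub>R u x)"
    using assms(2) by (simp add: set_integrable_def)
  then obtain v where v[measurable]: "v \<in> borel_measurable lborel"
    and eq: "AE x in lborel. indicator K x *\<^sub>R u x = v x"
    using completion_ex_borel_measurable_real[of "\<lambda>x. indicator K x *\<^sub>R u x" lborel]
      borel_measurable_integrable by blast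
  have "integrable lebesgue v"
    using int by (rule integrable_cong_AE_imp) (use eq in \<open>auto intro!: AE_completion measurable_completion elim: eventually_mono\<close>)
  then have "integrable lborel v" by (simp add: integrable_completion)
  moreover have "AE x in lborel. x \<in> K \<longrightarrow> v x = u x"
    using eq by (rule eventually_mono) auto
  ultimately show ?thesis by blast
qed

text \<open>The bridge from the integrals in \<open>weak_grad\<close> to those of the mollification
  part: \<psi> vanishes off K, and on K the representative agrees with u almost everywhere.\<close>

lemma set_integral_eq_lborel:
  fixes u v \<psi> :: "'a::euclidean_space \<Rightarrow> real"
  assumes K: "compact K" "K \<subseteq> \<Omega>" and u: "set_integrable lebesgue K u"
    and [measurable]: "v \<in> borel_measurable borel" "\<psi> \<in> borel_measurable borel"
    and eq: "AE x in lborel. x \<in> K \<longrightarrow> v x = u x"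
    and 0: "\<And>x. x \<notin> K \<Longrightarrow> \<psi> x = 0"
  shows "(LINT x:\<Omega>|lebesgue. u x * \<psi> x) = (LINT x|lborel. v x * \<psi> x)"
proof -
  have "(LINT x:\<Omega>|lebesgue. u x * \<psi> x) = (LINT x|lebesgue. (indicator K x *\<^sub>R u x) * \<psi> x)"
    unfolding set_lebesgue_integral_def
  proof (rule Bochner_Integration.integral_cong[OF refl])
    fix x
    show "indicat_real \<Omega> x *\<^sub>R (u x * \<psi> x) = (indicat_real K x *\<^sub>R u x) * \<psi> x"
      using 0[of x] K(2) by (cases "x \<in> K") (auto simp: indicator_def)
  qed
  also have "\<dots> = (LINT x|lebesgue. v x * \<psi> x)"
  proof (rule integral_cong_AE)
    have "(\<lambda>x. indicator K x *\<^sub>R u x) \<in> borel_measurable lebesgue"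
      using u unfolding set_integrable_def by (rule borel_measurable_integrable)
    moreover have "\<psi> \<in> borel_measurable lebesgue" by (intro measurable_completion) simp
    ultimately show "(\<lambda>x. (indicator K x *\<^sub>R u x) * \<psi> x) \<in> borel_measurable lebesgue"
      by (rule borel_measurable_times)
    show "(\<lambda>x. v x * \<psi> x) \<in> borel_measurable lebesgue" by (intro measurable_completion) simp
    show "AE x in lebesgue. (indicator K x *\<^sub>R u x) * \<psi> x = v x * \<psi> x"
      using AE_completion[OF eq] by (rule eventually_mono) (use 0 in \<open>auto simp: indicator_def\<close>)
  qed
  also have "\<dots> = (LINT x|lborel. v x * \<psi> x)"
    by (rule integral_completion) simp
  finally show ?thesis .
qed

lemma L1_loc_inner:
  assumes "L1_loc \<Omega> g"
  shows "L1_loc \<Omega> (\<lambda>x. g x \<bullet> i)"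
proof -
  have "set_integrable lebesgue K (\<lambda>x. g x \<bullet> i)" if "compact K" "K \<subseteq> \<Omega>" for K
  proof -
    have "integrable lebesgue (\<lambda>x. (indicator K x *\<^sub>R g x) \<bullet> i)"
      using assms that unfolding L1_loc_def set_integrable_def by (intro integrable_inner_left) auto
    then show ?thesis by (simp add: set_integrable_def)
  qed
  then show ?thesis using assms by (auto simp: L1_loc_def)
qed

text \<open>The weak gradient is tested against \<open>y \<mapsto> mollifier n (x - y)\<close>.\<close>
lemma mollify_derivative_weak_grad:
  fixes u v w :: "'a::euclidean_space \<Rightarrow> real"
  assumes wg: "weak_grad \<Omega> u g" and L: "compact L" "L \<subseteq> \<Omega>" and ball: "cball x \<delta> \<subseteq> L" and i: "i \<in> Basis"
    and v: "integrable lborel v" "AE x in lborel. x \<in> L \<longrightarrow> v x = u x"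
    and w: "integrable lborel w" "AE x in lborel. x \<in> L \<longrightarrow> w x = g x \<bullet> i"
    and n: "n > 0" "DIM('a) / n \<le> \<delta>"
  shows "((\<lambda>t. mollify n v (x + t *\<^sub>R i)) has_real_derivative mollify n w x) (at 0)"
proof -
  define \<psi> where "\<psi> y = mollifier n (x - y)" for y
  have sm: "smooth_fun \<psi>" unfolding \<psi>_def[abs_def] by (rule smooth_fun_mollifier_shift)
  \<comment> \<open>The condition DIM / n \<le> \<delta> confines the kernel to the ball, hence to
    L, where v and w represent u and the component of g.\<close>
  have \<psi>0: "\<psi> y = 0" if "y \<notin> cball x \<delta>" for y
    unfolding \<psi>_def by (rule mollifier_zero) (use n that in \<open>auto simp: dist_norm\<close>)
  have test: "test_fun \<Omega> \<psi>"
    using \<psi>0 ball L by (intro test_funI[OF sm, of "cball x \<delta>"]) auto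
  \<comment> \<open>Differentiating x - y in y gives a sign, which cancels the one in the definition
    of \<open>weak_grad\<close>.\<close>
  have d\<psi>: "frechet_derivative \<psi> (at y) i = - frechet_derivative (mollifier n) (at (x - y)) i" for y
  proof -
    have "((\<lambda>y. x - y) has_derivative (\<lambda>h. - h)) (at y)"
      by (auto intro!: derivative_eq_intros)
    from has_derivative_compose[OF this smooth_fun_has_derivative[OF smooth_fun_mollifier]]
    have "(\<psi> has_derivative (\<lambda>h. frechet_derivative (mollifier n) (at (x - y)) (- h))) (at y)"
      unfolding \<psi>_def[abs_def] .
    from fun_cong[OF frechet_derivative_at[OF this], of i]
    have "frechet_derivative \<psi> (at y) i = frechet_derivative (mollifier n) (at (x - y)) (- i)" by simp
    also have "\<dots> = - frechet_derivative (mollifier n) (at (x - y)) i"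
      using smooth_fun_has_derivative[OF smooth_fun_mollifier, of n "x - y"]
      by (simp add: has_derivative_def bounded_linear.linear linear_neg)
    finally show ?thesis .
  qed
  have d\<psi>0: "frechet_derivative \<psi> (at y) i = 0" if "y \<notin> cball x \<delta>" for y
  proof -
    have "(\<psi> has_derivative (\<lambda>_. 0)) (at y)"
      by (rule has_derivative_transform_within_open[where f="\<lambda>_. 0" and s="- cball x \<delta>"])
        (use that \<psi>0 in auto)
    from fun_cong[OF frechet_derivative_at[OF this], of i] show ?thesis by simp
  qed
  have off: "\<psi> y = 0" "frechet_derivative \<psi> (at y) i = 0" if "y \<notin> L" for y
    using that ball \<psi>0 d\<psi>0 by blast+
  have [measurable]: "\<psi> \<in> borel_measurable borel" "v \<in> borel_measurable borel" "w \<in> borel_measurable borel"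
    "(\<lambda>y. frechet_derivative \<psi> (at y) i) \<in> borel_measurable borel"
    using v w sm
    by (simp_all add: borel_measurable_continuous_onI smooth_fun_continuous smooth_fun_derivative)
  have loc: "set_integrable lebesgue L u" "set_integrable lebesgue L (\<lambda>x. g x \<bullet> i)"
    using wg L L1_loc_inner[of \<Omega> g i] by (auto simp: weak_grad_def L1_loc_def)
  have "(LINT y|lborel. v y * frechet_derivative \<psi> (at y) i)
      = (LINT y:\<Omega>|lebesgue. u y * frechet_derivative \<psi> (at y) i)"
    using L loc(1) v(2) off(2) by (intro set_integral_eq_lborel[symmetric]) simp_all
  also have "\<dots> = - (LINT y:\<Omega>|lebesgue. (g y \<bullet> i) * \<psi> y)"
    using wg test i by (simp add: weak_grad_def)
  also have "(LINT y:\<Omega>|lebesgue. (g y \<bullet> i) * \<psi> y) = (LINT y|lborel. w y * \<psi> y)"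
    using L loc(2) w(2) off(1) by (intro set_integral_eq_lborel) simp_all
  finally have "(LINT y|lborel. v y * frechet_derivative (mollifier n) (at (x - y)) i)
      = (LINT y|lborel. w y * \<psi> y)"
    by (simp add: d\<psi>)
  also have "\<dots> = mollify n w x" by (simp add: mollify_def \<psi>_def)
  finally have "(LINT y|lborel. v y * frechet_derivative (mollifier n) (at (x - y)) i) = mollify n w x" .
  with mollify_has_directional_derivative(1)[OF n(1) v(1), of x i] show ?thesis by simp
qed

text \<open>Makes room for mollification: kernels centred in K with radius at most \<delta> see only
  L, on which functions locally integrable in Omega are integrable.\<close>

lemma compact_neighbourhood:
  fixes K :: "'a::euclidean_space set"
  assumes "compact K" "open \<Omega>" "K \<subseteq> \<Omega>"
  obtains L \<delta> where "\<delta> > 0" "compact L" "K \<subseteq> L" "L \<subseteq> \<Omega>" "\<forall>x\<in>K. cball x \<delta> \<subseteq> L"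
proof -
  obtain \<delta> where \<delta>: "\<delta> > 0" "(\<Union>x\<in>K. cball x \<delta>) \<subseteq> \<Omega>"
    using compact_subset_open_imp_cball_epsilon_subset[OF assms] by blast
  define L where "L = {x + y |x y. x \<in> K \<and> y \<in> cball 0 \<delta>}"
  have cb: "cball x \<delta> \<subseteq> L" if "x \<in> K" for x
  proof
    fix z assume "z \<in> cball x \<delta>"
    then have "z = x + (z - x) \<and> x \<in> K \<and> z - x \<in> cball 0 \<delta>"
      using that by (simp add: dist_norm norm_minus_commute)
    then show "z \<in> L" unfolding L_def by blast
  qed
  have "compact L" unfolding L_def using assms by (intro compact_sums) auto
  moreover have "L \<subseteq> \<Omega>"
  proof
    fix z assume "z \<in> L"
    then obtain x y where "z = x + y" "x \<in> K" "norm y \<le> \<delta>" by (auto simp: L_def)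
    then have "z \<in> cball x \<delta>" by (simp add: dist_norm)
    with \<delta>(2) \<open>x \<in> K\<close> show "z \<in> \<Omega>" by blast
  qed
  moreover have "K \<subseteq> L" using cb \<delta>(1) by force
  ultimately show thesis using that \<delta>(1) cb by blast
qed

section \<open>Uniqueness of weak gradients\<close>

lemma eventually_mollifier_radius_le:
  "\<delta> > 0 \<Longrightarrow> \<forall>\<^sub>F m in sequentially. real d / real (Suc m) \<le> \<delta>"
proof -
  assume \<delta>: "\<delta> > 0"
  have "(\<lambda>m. real d * inverse (real (Suc m))) \<longlonglongrightarrow> real d * 0"
    by (intro tendsto_intros LIMSEQ_inverse_real_of_nat)
  then have "\<forall>\<^sub>F m in sequentially. real d * inverse (real (Suc m)) < \<delta>"
    using \<delta> by (intro order_tendstoD) auto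
  then show ?thesis by (rule eventually_mono) (simp add: divide_inverse)
qed

text \<open>On K, the mollified components of g and of h are both the derivative of the same
  mollified u, hence equal for all large m. Both sequences converge in L^1 on K, so their limits
  agree.\<close>

lemma weak_grad_unique_on_compact:
  fixes u :: "'a::euclidean_space \<Rightarrow> real"
  assumes \<Omega>: "open \<Omega>" and wg: "weak_grad \<Omega> u g" "weak_grad \<Omega> u h"
    and K: "compact K" "K \<subseteq> \<Omega>" and i: "i \<in> Basis"
  shows "AE x in lborel. x \<in> K \<longrightarrow> g x \<bullet> i = h x \<bullet> i"
proof -
  obtain \<delta> L where L: "\<delta> > 0" "compact L" "K \<subseteq> L" "L \<subseteq> \<Omega>" "\<forall>x\<in>K. cball x \<delta> \<subseteq> L"
    using compact_neighbourhood[OF K(1) \<Omega> K(2)] by metis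
  have "L1_loc \<Omega> u" "L1_loc \<Omega> (\<lambda>x. g x \<bullet> i)" "L1_loc \<Omega> (\<lambda>x. h x \<bullet> i)"
    using wg L1_loc_inner[of \<Omega> g i] L1_loc_inner[of \<Omega> h i] by (simp_all add: weak_grad_def)
  then have si: "set_integrable lebesgue L u" "set_integrable lebesgue L (\<lambda>x. g x \<bullet> i)"
    "set_integrable lebesgue L (\<lambda>x. h x \<bullet> i)" using L by (auto simp: L1_loc_def)
  obtain v where v: "integrable lborel v" "AE x in lborel. x \<in> L \<longrightarrow> v x = u x"
    using ex_borel_representative[OF L(2) si(1)] by blast
  obtain w where w: "integrable lborel w" "AE x in lborel. x \<in> L \<longrightarrow> w x = g x \<bullet> i"
    using ex_borel_representative[OF L(2) si(2)] by blast
  obtain z where z: "integrable lborel z" "AE x in lborel. x \<in> L \<longrightarrow> z x = h x \<bullet> i"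
    using ex_borel_representative[OF L(2) si(3)] by blast
  let ?I = "\<lambda>f m. LINT x|lborel. indicator K x * \<bar>mollify (real (Suc m)) f x - f x\<bar>"
  have iK: "integrable lborel (\<lambda>x. indicator K x * \<bar>w x - z x\<bar>)"
    using w z K by (intro integrable_indicator_mult) auto
  have "\<forall>\<^sub>F m in sequentially. (LINT x|lborel. indicator K x * \<bar>w x - z x\<bar>) \<le> ?I w m + ?I z m"
    using eventually_mollifier_radius_le[OF L(1), of "DIM('a)"]
  proof (rule eventually_mono)
    fix m assume m: "real DIM('a) / real (Suc m) \<le> \<delta>"
    have n: "real (Suc m) > 0" by simp
    have "mollify (real (Suc m)) w x = mollify (real (Suc m)) z x" if "x \<in> K" for x
      using DERIV_unique mollify_derivative_weak_grad[OF wg(1) L(2,4) bspec[OF L(5) that] i v w n m]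
        mollify_derivative_weak_grad[OF wg(2) L(2,4) bspec[OF L(5) that] i v z n m] by blast
    then have "indicator K x * \<bar>w x - z x\<bar> \<le> indicator K x * \<bar>mollify (real (Suc m)) w x - w x\<bar>
        + indicator K x * \<bar>mollify (real (Suc m)) z x - z x\<bar>" for x
      by (cases "x \<in> K") auto
    then have "(LINT x|lborel. indicator K x * \<bar>w x - z x\<bar>)
        \<le> (LINT x|lborel. indicator K x * \<bar>mollify (real (Suc m)) w x - w x\<bar>
          + indicator K x * \<bar>mollify (real (Suc m)) z x - z x\<bar>)"
      using K w z n by (intro integral_mono Bochner_Integration.integrable_add integrable_indicator_mult
          integrable_abs Bochner_Integration.integrable_diff mollify_integrable)
    also have "\<dots> = ?I w m + ?I z m"
      using K w z n by (intro Bochner_Integration.integral_add integrable_indicator_mult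
          integrable_abs Bochner_Integration.integrable_diff mollify_integrable)
    finally show "(LINT x|lborel. indicator K x * \<bar>w x - z x\<bar>) \<le> ?I w m + ?I z m" .
  qed
  moreover have "(\<lambda>m. ?I w m + ?I z m) \<longlonglongrightarrow> 0"
    using tendsto_add[OF mollify_tendsto_L1[OF w(1) K(1)] mollify_tendsto_L1[OF z(1) K(1)]] by simp
  ultimately have "(LINT x|lborel. indicator K x * \<bar>w x - z x\<bar>) \<le> 0"
    by (intro tendsto_lowerbound) auto
  moreover have "(LINT x|lborel. indicator K x * \<bar>w x - z x\<bar>) \<ge> 0" by simp
  ultimately have "AE x in lborel. indicator K x * \<bar>w x - z x\<bar> = 0"
    using integral_nonneg_eq_0_iff_AE[OF iK] by auto
  then show ?thesis
    using w(2) z(2) by eventually_elim (use L(3) in \<open>auto simp: indicator_def split: if_splits\<close>)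
qed

text \<open>Countably many compact boxes exhaust Omega and there are finitely many coordinates, so
  the exceptional null sets combine into one.\<close>

lemma weak_grad_unique:
  fixes u :: "'a::euclidean_space \<Rightarrow> real"
  assumes \<Omega>: "open \<Omega>" and wg: "weak_grad \<Omega> u g" "weak_grad \<Omega> u h"
  shows "AE x in lebesgue. x \<in> \<Omega> \<longrightarrow> g x = h x"
proof -
  obtain \<D> where D: "countable \<D>" "\<D> \<subseteq> Pow \<Omega>" "\<And>X. X \<in> \<D> \<Longrightarrow> \<exists>a b. X = cbox a b" "\<Union>\<D> = \<Omega>"
    using open_countable_Union_open_cbox[OF \<Omega>] by blast
  have "compact X" "X \<subseteq> \<Omega>" if "X \<in> \<D>" for X using D(2,3) that by (auto dest: D(3))
  then have "AE x in lborel. \<forall>i\<in>Basis. \<forall>X\<in>\<D>. x \<in> X \<longrightarrow> g x \<bullet> i = h x \<bullet> i"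
    unfolding AE_ball_countable[OF countable_finite[OF finite_Basis]] AE_ball_countable[OF D(1)]
    by (intro ballI weak_grad_unique_on_compact[OF \<Omega> wg])
  then have "AE x in lborel. x \<in> \<Omega> \<longrightarrow> g x = h x"
    by (rule eventually_mono) (use D(4) in \<open>blast intro: euclidean_eqI\<close>)
  then show ?thesis by (rule AE_completion)
qed

section \<open>Chain rule for C^1 functions with bounded derivative\<close>

context
  fixes G G' :: "real \<Rightarrow> real" and M :: real
  assumes G: "\<And>t. (G has_real_derivative G' t) (at t)"
    and G': "continuous_on UNIV G'" and M: "\<And>t. \<bar>G' t\<bar> \<le> M"
begin

lemma chain_lipschitz: "\<bar>G s - G t\<bar> \<le> M * \<bar>s - t\<bar>"
  using field_differentiable_bound[of UNIV G G' M s t] G M by (auto intro: DERIV_subset)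

lemma chain_measurable [measurable]: "G \<in> borel_measurable borel" "G' \<in> borel_measurable borel"
proof -
  have "continuous_on UNIV G"
    using G by (meson DERIV_continuous continuous_at_imp_continuous_on)
  then show "G \<in> borel_measurable borel" "G' \<in> borel_measurable borel"
    using G' by (simp_all add: borel_measurable_continuous_onI)
qed

lemma chain_bound: "\<bar>G t\<bar> \<le> \<bar>G 0\<bar> + M * \<bar>t\<bar>"
  using chain_lipschitz[of t 0] by simp

text \<open>G grows at most linearly, and the constant term is integrable on a compact set.\<close>

lemma L1_loc_compose:
  fixes u :: "'a::euclidean_space \<Rightarrow> real"
  assumes u: "L1_loc \<Omega> u"
  shows "L1_loc \<Omega> (\<lambda>x. G (u x))"
proof -
  have "(\<lambda>x. G (u x)) \<in> borel_measurable (lebesgue_on \<Omega>)"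
    using u measurable_compose[OF _ chain_measurable(1)] by (auto simp: L1_loc_def)
  moreover have "set_integrable lebesgue K (\<lambda>x. G (u x))" if K: "compact K" "K \<subseteq> \<Omega>" for K
  proof -
    have uK: "set_integrable lebesgue K u" using u K by (simp add: L1_loc_def)
    have lm: "K \<in> lmeasurable" using K(1) by (rule lmeasurable_compact)
    then have "set_integrable lebesgue K (\<lambda>x. G 0)"
      by (simp add: set_integrable_def lmeasurable_iff_integrable)
    then have b: "set_integrable lebesgue K (\<lambda>x. \<bar>G 0\<bar> + M * \<bar>u x\<bar>)"
      using uK by (intro set_integral_add set_integrable_mult_right set_integrable_abs) auto
    have K': "K \<in> sets lebesgue" using lm by auto
    have "set_borel_measurable lebesgue K u"
      using uK by (simp add: set_borel_measurable_def set_integrable_def borel_measurable_integrable)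
    then have "u \<in> borel_measurable (lebesgue_on K)"
      using K' by (simp add: borel_measurable_restrict_space_iff set_borel_measurable_def)
    then have "(\<lambda>x. G (u x)) \<in> borel_measurable (lebesgue_on K)"
      by (rule measurable_compose[OF _ chain_measurable(1)])
    then have "set_borel_measurable lebesgue K (\<lambda>x. G (u x))"
      using K' by (simp add: borel_measurable_restrict_space_iff set_borel_measurable_def)
    moreover have "norm (G (u x)) \<le> norm (\<bar>G 0\<bar> + M * \<bar>u x\<bar>)" for x
      using chain_bound[of "u x"] by simp
    ultimately show ?thesis by (intro set_integrable_bound[OF b]) auto
  qed
  ultimately show ?thesis by (simp add: L1_loc_def)
qed

lemma L1_loc_compose_deriv:
  fixes u :: "'a::euclidean_space \<Rightarrow> real" and g :: "'a \<Rightarrow> 'a"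
  assumes u: "L1_loc \<Omega> u" and g: "L1_loc \<Omega> g"
  shows "L1_loc \<Omega> (\<lambda>x. G' (u x) *\<^sub>R g x)"
proof -
  have "(\<lambda>x. G' (u x) *\<^sub>R g x) \<in> borel_measurable (lebesgue_on \<Omega>)"
    using u g measurable_compose[OF _ chain_measurable(2)]
    by (auto simp: L1_loc_def intro!: borel_measurable_scaleR)
  moreover have "set_integrable lebesgue K (\<lambda>x. G' (u x) *\<^sub>R g x)" if K: "compact K" "K \<subseteq> \<Omega>" for K
  proof -
    have uK: "set_integrable lebesgue K u" and gK: "set_integrable lebesgue K g"
      using u g K by (simp_all add: L1_loc_def)
    have b: "set_integrable lebesgue K (\<lambda>x. M * norm (g x))"
      using gK by (intro set_integrable_mult_right set_integrable_norm) auto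
    have K': "K \<in> sets lebesgue" using K(1) by (blast intro: lmeasurable_compact fmeasurableD)
    have "set_borel_measurable lebesgue K u" "set_borel_measurable lebesgue K g"
      using uK gK by (simp_all add: set_borel_measurable_def set_integrable_def borel_measurable_integrable)
    then have "u \<in> borel_measurable (lebesgue_on K)" "g \<in> borel_measurable (lebesgue_on K)"
      using K' by (simp_all add: borel_measurable_restrict_space_iff set_borel_measurable_def)
    then have "(\<lambda>x. G' (u x) *\<^sub>R g x) \<in> borel_measurable (lebesgue_on K)"
      by (intro borel_measurable_scaleR measurable_compose[OF _ chain_measurable(2)])
    then have "set_borel_measurable lebesgue K (\<lambda>x. G' (u x) *\<^sub>R g x)"
      using K' by (simp add: borel_measurable_restrict_space_iff set_borel_measurable_def)
    moreover have "norm (G' (u x) *\<^sub>R g x) \<le> norm (M * norm (g x))" for x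
      using M[of "u x"] mult_right_mono[OF M, of "norm (g x)" "u x"] by (simp add: abs_mult)
    ultimately show ?thesis using b by (intro set_integrable_bound[OF b]) auto
  qed
  ultimately show ?thesis by (simp add: L1_loc_def)
qed

text \<open>The derivative of the product of \<phi> and G(vn) has integral 0, where vn and wn are
  the mollifications of v and w; its two terms are the two sides of the claim.\<close>

lemma integral_compose_mollify:
  fixes v w \<phi> :: "'a::euclidean_space \<Rightarrow> real"
  assumes \<phi>: "smooth_fun \<phi>" and K: "compact K" "\<And>x. x \<notin> K \<Longrightarrow> \<phi> x = 0"
      "\<And>x. x \<notin> K \<Longrightarrow> frechet_derivative \<phi> (at x) i = 0"
    and v: "integrable lborel v" and w: "integrable lborel w" and n: "n > 0"
    and der: "\<And>x. x \<in> K \<Longrightarrow>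
      ((\<lambda>t. mollify n v (x + t *\<^sub>R i)) has_real_derivative mollify n w x) (at 0)"
  shows "(LINT x|lborel. G (mollify n v x) * frechet_derivative \<phi> (at x) i)
    = - (LINT x|lborel. G' (mollify n v x) * mollify n w x * \<phi> x)"
proof -
  define vn where "vn = mollify n v"
  define wn where "wn = mollify n w"
  define d\<phi> where "d\<phi> x = frechet_derivative \<phi> (at x) i" for x
  \<comment> \<open>The derivative of vn exists everywhere in this form but is identified with wn
    only on K. Off K the factor \<phi> is 0, so the product is unaffected by the
    replacement.\<close>
  define D where "D x = (LINT y|lborel. v y * frechet_derivative (mollifier n) (at (x - y)) i)" for x
  obtain B where "\<And>x. \<bar>D x\<bar> \<le> B"
    using mollify_has_directional_derivative(2)[OF n v, of i] unfolding D_def by blast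
  then have D: "\<And>x. ((\<lambda>t. vn (x + t *\<^sub>R i)) has_real_derivative D x) (at 0)" "\<And>x. \<bar>D x\<bar> \<le> B"
    using mollify_has_directional_derivative(1)[OF n v] by (simp_all only: vn_def D_def)
  have DK: "D x = wn x" if "x \<in> K" for x
    using DERIV_unique[OF D(1)] der[OF that] unfolding vn_def wn_def by blast
  have c: "continuous_on UNIV \<phi>" "continuous_on UNIV d\<phi>"
    unfolding d\<phi>_def[abs_def] using \<phi> by (simp_all add: smooth_fun_continuous smooth_fun_derivative)
  note [measurable] = borel_measurable_continuous_onI[OF c(1)] borel_measurable_continuous_onI[OF c(2)]
  have [measurable]: "v \<in> borel_measurable borel" "w \<in> borel_measurable borel" using v w by auto
  have [measurable]: "vn \<in> borel_measurable borel" "wn \<in> borel_measurable borel"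
    unfolding vn_def wn_def by measurable
  have d0: "d\<phi> x = 0" if "x \<notin> K" for x using K(3) that by (simp add: d\<phi>_def)
  obtain B1 where B1: "\<And>x. \<bar>\<phi> x\<bar> \<le> B1"
    using continuous_compact_support_bounded[OF c(1) K(1,2)] by blast
  obtain B2 where B2: "\<And>x. \<bar>d\<phi> x\<bar> \<le> B2"
    using continuous_compact_support_bounded[OF c(2) K(1) d0] by blast
  obtain B3 where B3: "\<And>x. \<bar>vn x\<bar> \<le> B3"
    using mollify_bounded[OF n v] unfolding vn_def by blast
  have nn: "0 \<le> B" "0 \<le> B1" "0 \<le> B2" "0 \<le> M"
    using D(2)[of 0] B1[of 0] B2[of 0] M[of 0] by linarith+
  define B4 where "B4 = \<bar>G 0\<bar> + M * B3"
  have B4: "\<bar>G (vn x)\<bar> \<le> B4" for x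
    using chain_bound[of "vn x"] mult_left_mono[OF B3 nn(4), of x] unfolding B4_def by linarith
  have i\<phi>: "integrable lborel \<phi>" "integrable lborel d\<phi>"
    using continuous_compact_support_integrable[OF c(1) K(1,2)]
      continuous_compact_support_integrable[OF c(2) K(1) d0] by auto
  have int1: "integrable lborel (\<lambda>x. \<phi> x * G (vn x))" "integrable lborel (\<lambda>x. d\<phi> x * G (vn x))"
    using i\<phi> B4 by (intro integrable_mult_bounded[of _ _ _ B4]; simp)+
  have int2: "integrable lborel (\<lambda>x. wn x * (G' (vn x) * \<phi> x))"
  proof (rule integrable_mult_bounded)
    show "integrable lborel wn" unfolding wn_def by (rule mollify_integrable[OF n w])
    show "\<bar>G' (vn x) * \<phi> x\<bar> \<le> M * B1" for x
      unfolding abs_mult using M B1 nn by (intro mult_mono) auto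
  qed measurable
  have "(LINT x|lborel. G' (vn x) * D x * \<phi> x + d\<phi> x * G (vn x)) = 0"
  proof (rule integral_directional_derivative_eq_0[where K=K])
    show "((\<lambda>t. \<phi> (x + t *\<^sub>R i) * G (vn (x + t *\<^sub>R i))) has_real_derivative
        G' (vn x) * D x * \<phi> x + d\<phi> x * G (vn x)) (at 0)" for x
    proof -
      have "(G has_real_derivative G' (vn x)) (at (vn (x + 0 *\<^sub>R i)))" using G by simp
      from DERIV_chain2[OF this D(1)] smooth_fun_directional_derivative[OF \<phi>, of x i]
      show ?thesis
        by (auto intro!: derivative_eq_intros simp: d\<phi>_def)
    qed
    show "\<bar>G' (vn x) * D x * \<phi> x + d\<phi> x * G (vn x)\<bar> \<le> M * B * B1 + B2 * B4" for x
    proof -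
      have "\<bar>G' (vn x) * D x * \<phi> x\<bar> \<le> M * B * B1"
        unfolding abs_mult using M B1 D(2) nn by (intro mult_mono) auto
      moreover have "\<bar>d\<phi> x * G (vn x)\<bar> \<le> B2 * B4"
        unfolding abs_mult using B2 B4 nn by (intro mult_mono) auto
      ultimately show ?thesis by linarith
    qed
  qed (use int1 K in auto)
  moreover have "G' (vn x) * D x * \<phi> x + d\<phi> x * G (vn x)
      = wn x * (G' (vn x) * \<phi> x) + d\<phi> x * G (vn x)" for x
    using DK[of x] K(2)[of x] by (cases "x \<in> K") auto
  ultimately have "(LINT x|lborel. wn x * (G' (vn x) * \<phi> x)) + (LINT x|lborel. d\<phi> x * G (vn x)) = 0"
    using int1 int2 by simp
  then show ?thesis
    unfolding vn_def wn_def d\<phi>_def by (simp add: mult_ac)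
qed

text \<open>On the left, G is Lipschitz, so L^1 convergence of vn on K suffices. On the right, wn is
  split as (wn - w) + w: the first part tends to 0 because G' is bounded, the second by dominated
  convergence.\<close>

lemma integral_compose_limit:
  fixes v w \<phi> :: "'a::euclidean_space \<Rightarrow> real"
  assumes \<phi>: "smooth_fun \<phi>" and K: "compact K" "\<And>x. x \<notin> K \<Longrightarrow> \<phi> x = 0"
      "\<And>x. x \<notin> K \<Longrightarrow> frechet_derivative \<phi> (at x) i = 0"
    and v: "integrable lborel v" and w: "integrable lborel w"
    and der: "\<forall>\<^sub>F m in sequentially. \<forall>x\<in>K.
      ((\<lambda>t. mollify (real (Suc m)) v (x + t *\<^sub>R i)) has_real_derivative mollify (real (Suc m)) w x) (at 0)"
  shows "(LINT x|lborel. G (v x) * frechet_derivative \<phi> (at x) i)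
    = - (LINT x|lborel. G' (v x) * w x * \<phi> x)"
proof -
  define vn where "vn m = mollify (real (Suc m)) v" for m
  define wn where "wn m = mollify (real (Suc m)) w" for m
  define d\<phi> where "d\<phi> x = frechet_derivative \<phi> (at x) i" for x
  have c: "continuous_on UNIV \<phi>" "continuous_on UNIV d\<phi>"
    unfolding d\<phi>_def[abs_def] using \<phi> by (simp_all add: smooth_fun_continuous smooth_fun_derivative)
  note [measurable] = borel_measurable_continuous_onI[OF c(1)] borel_measurable_continuous_onI[OF c(2)]
  have [measurable]: "v \<in> borel_measurable borel" "w \<in> borel_measurable borel" using v w by auto
  have vwn: "integrable lborel (vn m)" "integrable lborel (wn m)" for m
    unfolding vn_def wn_def using v w by (auto intro: mollify_integrable)
  then have [measurable]: "vn m \<in> borel_measurable borel" "wn m \<in> borel_measurable borel" for m by auto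
  have d0: "d\<phi> x = 0" if "x \<notin> K" for x using K(3) that by (simp add: d\<phi>_def)
  obtain B1 where B1: "\<And>x. \<bar>\<phi> x\<bar> \<le> B1"
    using continuous_compact_support_bounded[OF c(1) K(1,2)] by blast
  obtain B2 where B2: "\<And>x. \<bar>d\<phi> x\<bar> \<le> B2"
    using continuous_compact_support_bounded[OF c(2) K(1) d0] by blast
  have nn: "0 \<le> B1" "0 \<le> B2" "0 \<le> M"
    using B1[of 0] B2[of 0] M[of 0] by linarith+
  have id\<phi>: "integrable lborel d\<phi>"
    using continuous_compact_support_integrable[OF c(2) K(1) d0] .
  have iG: "integrable lborel (\<lambda>x. G (f x) * d\<phi> x)" if f: "integrable lborel f" for f
  proof -
    have [measurable]: "f \<in> borel_measurable borel" using f by simp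
    \<comment> \<open>A nonzero constant is not integrable on the whole space, so G 0 is split off
      and integrated only against the compactly supported d\<phi>.\<close>
    have "integrable lborel (\<lambda>x. G (f x) - G 0)"
      by (rule Bochner_Integration.integrable_bound[of _ "\<lambda>x. M * \<bar>f x\<bar>"])
        (use f chain_lipschitz[of _ 0] nn in \<open>auto simp: abs_mult\<close>)
    then have "integrable lborel (\<lambda>x. (G (f x) - G 0) * d\<phi> x)"
      using B2 by (intro integrable_mult_bounded[of _ _ _ B2]) auto
    from Bochner_Integration.integrable_add[OF this integrable_mult_right[OF id\<phi>, of "G 0"]]
    show ?thesis by (simp add: left_diff_distrib)
  qed
  have iG': "integrable lborel (\<lambda>x. h x * (G' (f x) * \<phi> x))"
    if h: "integrable lborel h" and [measurable]: "f \<in> borel_measurable borel" for f h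
  proof (rule integrable_mult_bounded[OF h])
    show "\<bar>G' (f x) * \<phi> x\<bar> \<le> M * B1" for x
      unfolding abs_mult using M B1 nn by (intro mult_mono) auto
  qed measurable
  have L1: "(\<lambda>m. LINT x|lborel. indicator K x * \<bar>vn m x - v x\<bar>) \<longlonglongrightarrow> 0"
    "(\<lambda>m. LINT x|lborel. indicator K x * \<bar>wn m x - w x\<bar>) \<longlonglongrightarrow> 0"
    unfolding vn_def wn_def using mollify_tendsto_L1 v w K by blast+
  have iK: "integrable lborel (\<lambda>x. indicator K x * \<bar>vn m x - v x\<bar>)"
    "integrable lborel (\<lambda>x. indicator K x * \<bar>wn m x - w x\<bar>)"
    "integrable lborel (\<lambda>x. indicator K x * (vn m x - v x))" for m
    using v w vwn K by (auto intro!: integrable_indicator_mult)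
  \<comment> \<open>G' is merely continuous, so L^1 convergence of vn says nothing directly about
    G'(vn). A subsequence converging almost everywhere on K does.\<close>
  have "(\<lambda>m. LINT x|lborel. norm (indicator K x * (vn m x - v x))) \<longlonglongrightarrow> 0"
    using L1(1) by (simp add: abs_mult)
  from tendsto_L1_AE_subseq[OF iK(3) this]
  obtain r where r: "strict_mono r" "AE x in lborel. (\<lambda>m. indicator K x * (vn (r m) x - v x)) \<longlonglongrightarrow> 0"
    by blast
  have left: "(\<lambda>m. LINT x|lborel. G (vn m x) * d\<phi> x) \<longlonglongrightarrow> (LINT x|lborel. G (v x) * d\<phi> x)"
  proof (rule LIM_zero_cancel, rule Lim_null_comparison)
    show "(\<lambda>m. M * B2 * (LINT x|lborel. indicator K x * \<bar>vn m x - v x\<bar>)) \<longlonglongrightarrow> 0"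
      using tendsto_mult_right_zero[OF L1(1)] by simp
    show "\<forall>\<^sub>F m in sequentially. norm ((LINT x|lborel. G (vn m x) * d\<phi> x) - (LINT x|lborel. G (v x) * d\<phi> x))
        \<le> M * B2 * (LINT x|lborel. indicator K x * \<bar>vn m x - v x\<bar>)"
    proof (rule always_eventually, rule allI)
      fix m
      have "\<bar>G (vn m x) * d\<phi> x - G (v x) * d\<phi> x\<bar> \<le> M * B2 * (indicator K x * \<bar>vn m x - v x\<bar>)" for x
      proof (cases "x \<in> K")
        case True
        have "\<bar>G (vn m x) - G (v x)\<bar> * \<bar>d\<phi> x\<bar> \<le> (M * \<bar>vn m x - v x\<bar>) * B2"
          using chain_lipschitz B2 nn by (intro mult_mono) auto
        moreover have "\<bar>G (vn m x) * d\<phi> x - G (v x) * d\<phi> x\<bar> = \<bar>G (vn m x) - G (v x)\<bar> * \<bar>d\<phi> x\<bar>"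
          by (simp add: abs_mult flip: left_diff_distrib)
        ultimately show ?thesis using True by (simp add: mult_ac)
      qed (simp add: d0)
      then have "\<bar>LINT x|lborel. G (vn m x) * d\<phi> x - G (v x) * d\<phi> x\<bar>
          \<le> (LINT x|lborel. M * B2 * (indicator K x * \<bar>vn m x - v x\<bar>))"
        using iG vwn v iK by (intro abs_integral_le) auto
      then show "norm ((LINT x|lborel. G (vn m x) * d\<phi> x) - (LINT x|lborel. G (v x) * d\<phi> x))
        \<le> M * B2 * (LINT x|lborel. indicator K x * \<bar>vn m x - v x\<bar>)"
        using iG[OF vwn(1)] iG[OF v] by simp
    qed
  qed
  have right1: "(\<lambda>m. LINT x|lborel. (wn m x - w x) * (G' (vn m x) * \<phi> x)) \<longlonglongrightarrow> 0"
  proof (rule Lim_null_comparison)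
    show "(\<lambda>m. M * B1 * (LINT x|lborel. indicator K x * \<bar>wn m x - w x\<bar>)) \<longlonglongrightarrow> 0"
      using tendsto_mult_right_zero[OF L1(2)] by simp
    show "\<forall>\<^sub>F m in sequentially. norm (LINT x|lborel. (wn m x - w x) * (G' (vn m x) * \<phi> x))
        \<le> M * B1 * (LINT x|lborel. indicator K x * \<bar>wn m x - w x\<bar>)"
    proof (rule always_eventually, rule allI)
      fix m
      have "\<bar>(wn m x - w x) * (G' (vn m x) * \<phi> x)\<bar> \<le> M * B1 * (indicator K x * \<bar>wn m x - w x\<bar>)" for x
      proof (cases "x \<in> K")
        case True
        have "\<bar>wn m x - w x\<bar> * (\<bar>G' (vn m x)\<bar> * \<bar>\<phi> x\<bar>) \<le> \<bar>wn m x - w x\<bar> * (M * B1)"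
          using M B1 nn by (intro mult_mono) auto
        then show ?thesis using True by (simp add: abs_mult mult_ac)
      qed (simp add: K)
      then have "\<bar>LINT x|lborel. (wn m x - w x) * (G' (vn m x) * \<phi> x)\<bar>
          \<le> (LINT x|lborel. M * B1 * (indicator K x * \<bar>wn m x - w x\<bar>))"
        using vwn w iK by (intro abs_integral_le iG') auto
      then show "norm (LINT x|lborel. (wn m x - w x) * (G' (vn m x) * \<phi> x))
        \<le> M * B1 * (LINT x|lborel. indicator K x * \<bar>wn m x - w x\<bar>)" by simp
    qed
  qed
  have right2: "(\<lambda>m. LINT x|lborel. w x * (G' (vn (r m) x) * \<phi> x)) \<longlonglongrightarrow> (LINT x|lborel. w x * (G' (v x) * \<phi> x))"
  proof (rule integral_dominated_convergence[where w="\<lambda>x. \<bar>w x\<bar> * (M * B1)"])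
    show "AE x in lborel. (\<lambda>m. w x * (G' (vn (r m) x) * \<phi> x)) \<longlonglongrightarrow> w x * (G' (v x) * \<phi> x)"
      using r(2)
    proof (rule eventually_mono)
      fix x assume x: "(\<lambda>m. indicator K x * (vn (r m) x - v x)) \<longlonglongrightarrow> 0"
      show "(\<lambda>m. w x * (G' (vn (r m) x) * \<phi> x)) \<longlonglongrightarrow> w x * (G' (v x) * \<phi> x)"
      proof (cases "x \<in> K")
        case True
        then have "(\<lambda>m. vn (r m) x) \<longlonglongrightarrow> v x"
          using x by (simp add: LIM_zero_iff)
        moreover have "isCont G' (v x)"
          using G' by (simp add: continuous_on_eq_continuous_at)
        ultimately show ?thesis
          by (intro tendsto_intros isCont_tendsto_compose[of _ G'])
      qed (simp add: K)
    qed
    show "AE x in lborel. norm (w x * (G' (vn (r m) x) * \<phi> x)) \<le> \<bar>w x\<bar> * (M * B1)" for m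
    proof (rule AE_I2)
      fix x
      show "norm (w x * (G' (vn (r m) x) * \<phi> x)) \<le> \<bar>w x\<bar> * (M * B1)"
        unfolding real_norm_def abs_mult using M B1 nn by (intro mult_mono) auto
    qed
  qed (use w in auto)
  have eq: "\<forall>\<^sub>F m in sequentially. (LINT x|lborel. G (vn m x) * d\<phi> x)
      = - ((LINT x|lborel. (wn m x - w x) * (G' (vn m x) * \<phi> x)) + (LINT x|lborel. w x * (G' (vn m x) * \<phi> x)))"
    using der
  proof (rule eventually_mono)
    fix m assume m: "\<forall>x\<in>K. ((\<lambda>t. mollify (real (Suc m)) v (x + t *\<^sub>R i))
      has_real_derivative mollify (real (Suc m)) w x) (at 0)"
    have "(LINT x|lborel. G (vn m x) * d\<phi> x) = - (LINT x|lborel. G' (vn m x) * wn m x * \<phi> x)"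
      unfolding vn_def wn_def d\<phi>_def
      by (rule integral_compose_mollify[OF \<phi> K v w]) (use m in auto)
    also have "(LINT x|lborel. G' (vn m x) * wn m x * \<phi> x)
        = (LINT x|lborel. (wn m x - w x) * (G' (vn m x) * \<phi> x) + w x * (G' (vn m x) * \<phi> x))"
      by (intro Bochner_Integration.integral_cong) (simp_all add: algebra_simps)
    also have "\<dots> = (LINT x|lborel. (wn m x - w x) * (G' (vn m x) * \<phi> x)) + (LINT x|lborel. w x * (G' (vn m x) * \<phi> x))"
      using vwn w by (intro Bochner_Integration.integral_add iG') auto
    finally show "(LINT x|lborel. G (vn m x) * d\<phi> x)
      = - ((LINT x|lborel. (wn m x - w x) * (G' (vn m x) * \<phi> x)) + (LINT x|lborel. w x * (G' (vn m x) * \<phi> x)))" .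
  qed
  have fr: "filterlim r sequentially sequentially" using r(1) by (rule filterlim_subseq)
  have "(\<lambda>m. - ((LINT x|lborel. (wn (r m) x - w x) * (G' (vn (r m) x) * \<phi> x))
      + (LINT x|lborel. w x * (G' (vn (r m) x) * \<phi> x)))) \<longlonglongrightarrow> - (0 + (LINT x|lborel. w x * (G' (v x) * \<phi> x)))"
    using filterlim_compose[OF right1 fr] right2 by (intro tendsto_intros)
  moreover have "\<forall>\<^sub>F m in sequentially. - ((LINT x|lborel. (wn (r m) x - w x) * (G' (vn (r m) x) * \<phi> x))
      + (LINT x|lborel. w x * (G' (vn (r m) x) * \<phi> x))) = (LINT x|lborel. G (vn (r m) x) * d\<phi> x)"
    using eventually_compose_filterlim[OF eq fr] by (rule eventually_mono) simp
  ultimately have "(\<lambda>m. LINT x|lborel. G (vn (r m) x) * d\<phi> x)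
      \<longlonglongrightarrow> - (0 + (LINT x|lborel. w x * (G' (v x) * \<phi> x)))"
    by (rule Lim_transform_eventually)
  from LIMSEQ_unique[OF filterlim_compose[OF left fr] this] show ?thesis
    unfolding d\<phi>_def by (simp add: mult_ac)
qed

text \<open>Representatives are taken on the larger L, so that mollifying at points of K uses only
  true values of u and g. The lemma is applied to k sin (t/k) and to t + d, both with M = 1.\<close>

lemma weak_grad_compose:
  fixes u :: "'a::euclidean_space \<Rightarrow> real"
  assumes \<Omega>: "open \<Omega>" and wg: "weak_grad \<Omega> u g"
  shows "weak_grad \<Omega> (\<lambda>x. G (u x)) (\<lambda>x. G' (u x) *\<^sub>R g x)"
proof -
  have loc: "L1_loc \<Omega> u" "L1_loc \<Omega> g" using wg by (simp_all add: weak_grad_def)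
  have loc': "L1_loc \<Omega> (\<lambda>x. G (u x))" "L1_loc \<Omega> (\<lambda>x. G' (u x) *\<^sub>R g x)"
    using loc by (simp_all add: L1_loc_compose L1_loc_compose_deriv)
  have "(LINT x:\<Omega>|lebesgue. G (u x) * frechet_derivative \<phi> (at x) i)
      = - (LINT x:\<Omega>|lebesgue. ((G' (u x) *\<^sub>R g x) \<bullet> i) * \<phi> x)"
    if test: "test_fun \<Omega> \<phi>" and i: "i \<in> Basis" for \<phi> i
  proof -
    obtain K where K: "compact K" "K \<subseteq> \<Omega>" "\<And>x. x \<notin> K \<Longrightarrow> \<phi> x = 0"
      "\<And>x v. x \<notin> K \<Longrightarrow> frechet_derivative \<phi> (at x) v = 0"
      by (rule test_fun_support[OF test]) blast
    have \<phi>: "smooth_fun \<phi>" using test by (rule test_fun_smooth)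
    note [measurable] = smooth_fun_measurable[OF \<phi>] smooth_fun_measurable[OF smooth_fun_derivative[OF \<phi>]]
    obtain L \<delta> where L: "\<delta> > 0" "compact L" "K \<subseteq> L" "L \<subseteq> \<Omega>" "\<forall>x\<in>K. cball x \<delta> \<subseteq> L"
      using compact_neighbourhood[OF K(1) \<Omega> K(2)] by metis
    have si: "set_integrable lebesgue L u" "set_integrable lebesgue L (\<lambda>x. g x \<bullet> i)"
      using loc(1) L1_loc_inner[OF loc(2), of i] L by (simp_all add: L1_loc_def)
    have si': "set_integrable lebesgue K (\<lambda>x. G (u x))"
      "set_integrable lebesgue K (\<lambda>x. (G' (u x) *\<^sub>R g x) \<bullet> i)"
      using loc'(1) L1_loc_inner[OF loc'(2), of i] K(1,2) by (simp_all add: L1_loc_def)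
    obtain v where v: "integrable lborel v" "AE x in lborel. x \<in> L \<longrightarrow> v x = u x"
      using ex_borel_representative[OF L(2) si(1)] by blast
    obtain w where w: "integrable lborel w" "AE x in lborel. x \<in> L \<longrightarrow> w x = g x \<bullet> i"
      using ex_borel_representative[OF L(2) si(2)] by blast
    have [measurable]: "v \<in> borel_measurable borel" "w \<in> borel_measurable borel" using v w by auto
    have AE1: "AE x in lborel. x \<in> K \<longrightarrow> G (v x) = G (u x)"
      using v(2) by (rule eventually_mono) (use L(3) in auto)
    have AE2: "AE x in lborel. x \<in> K \<longrightarrow> G' (v x) * w x = (G' (u x) *\<^sub>R g x) \<bullet> i"
      using v(2) w(2) by eventually_elim (use L(3) in auto)
    have "(LINT x:\<Omega>|lebesgue. G (u x) * frechet_derivative \<phi> (at x) i)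
        = (LINT x|lborel. G (v x) * frechet_derivative \<phi> (at x) i)"
      by (rule set_integral_eq_lborel[OF K(1,2) si'(1) _ _ AE1]) (use K(4) in simp_all)
    also have "\<dots> = - (LINT x|lborel. G' (v x) * w x * \<phi> x)"
    proof (rule integral_compose_limit[OF \<phi> K(1,3,4) v(1) w(1)])
      show "\<forall>\<^sub>F m in sequentially. \<forall>x\<in>K. ((\<lambda>t. mollify (real (Suc m)) v (x + t *\<^sub>R i))
          has_real_derivative mollify (real (Suc m)) w x) (at 0)"
        using eventually_mollifier_radius_le[OF L(1), of "DIM('a)"]
      proof (rule eventually_mono, intro ballI)
        fix m x assume m: "real DIM('a) / real (Suc m) \<le> \<delta>" and x: "x \<in> K"
        show "((\<lambda>t. mollify (real (Suc m)) v (x + t *\<^sub>R i)) has_real_derivative mollify (real (Suc m)) w x) (at 0)"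
          by (rule mollify_derivative_weak_grad[OF wg L(2,4) bspec[OF L(5) x] i v w _ m]) simp
      qed
    qed
    also have "(LINT x|lborel. G' (v x) * w x * \<phi> x) = (LINT x:\<Omega>|lebesgue. ((G' (u x) *\<^sub>R g x) \<bullet> i) * \<phi> x)"
      by (rule set_integral_eq_lborel[OF K(1,2) si'(2) _ _ AE2, symmetric]) (use K(3) in simp_all)
    finally show ?thesis .
  qed
  then show ?thesis using loc' by (simp add: weak_grad_def)
qed

end

text \<open>The equality is one of predicates, not just of gradients almost everywhere:
  \<open>wgrad\<close> picks its value by \<open>SOME\<close> from this predicate, so it is
  literally the same for u and u + c.\<close>

lemma weak_grad_add_const:
  fixes u :: "'a::euclidean_space \<Rightarrow> real"
  assumes "open \<Omega>"
  shows "weak_grad \<Omega> (\<lambda>x. u x + c) = weak_grad \<Omega> u"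
proof -
  have *: "weak_grad \<Omega> (\<lambda>x. f x + d) g" if "weak_grad \<Omega> f g" for f g d
  proof -
    have "((\<lambda>t. t + d) has_real_derivative 1) (at t)" for t
      by (auto intro!: derivative_eq_intros)
    from weak_grad_compose[OF this _ _ assms that, of 1] show ?thesis by simp
  qed
  show ?thesis
    using *[of "\<lambda>x. u x + c" _ "- c"] *[of u _ c] by (auto simp: fun_eq_iff)
qed

lemma wgrad_add_const:
  fixes u :: "'a::euclidean_space \<Rightarrow> real"
  assumes "open \<Omega>"
  shows "wgrad \<Omega> (\<lambda>x. u x + c) = wgrad \<Omega> u"
  by (simp add: wgrad_def weak_grad_add_const[OF assms])

section \<open>Extension domains\<close>

lemma powr_abs_add_le:
  fixes a b p :: real
  assumes "p \<ge> 0"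
  shows "\<bar>a + b\<bar> powr p \<le> 2 powr p * (\<bar>a\<bar> powr p + \<bar>b\<bar> powr p)"
proof -
  have "\<bar>a + b\<bar> powr p \<le> (2 * max \<bar>a\<bar> \<bar>b\<bar>) powr p"
    using assms by (intro powr_mono2) auto
  also have "\<dots> = 2 powr p * max \<bar>a\<bar> \<bar>b\<bar> powr p" by (simp add: powr_mult)
  also have "\<dots> \<le> 2 powr p * (\<bar>a\<bar> powr p + \<bar>b\<bar> powr p)"
    by (intro mult_left_mono) (auto simp: max_def)
  finally show ?thesis .
qed

lemma weak_grad_wgrad: "weak_grad \<Omega> u g \<Longrightarrow> weak_grad \<Omega> u (wgrad \<Omega> u)"
  unfolding wgrad_def by (rule someI[of "weak_grad \<Omega> u"])

lemma set_integral_lebesgue_on: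
  fixes f :: "'a::euclidean_space \<Rightarrow> real"
  assumes "\<Omega> \<in> sets lebesgue"
  shows "(LINT x:\<Omega>|lebesgue. f x) = (LINT x|lebesgue_on \<Omega>. f x)"
    and "set_integrable lebesgue \<Omega> f \<longleftrightarrow> integrable (lebesgue_on \<Omega>) f"
  using assms by (simp_all add: set_lebesgue_integral_def set_integrable_def
      integral_restrict_space integrable_restrict_space)

text \<open>Uniqueness turns the unspecified choice \<open>wgrad\<close> into something computable:
  any known weak gradient gives the same integral.\<close>

lemma integral_wgrad:
  fixes u :: "'a::euclidean_space \<Rightarrow> real"
  assumes \<Omega>: "open \<Omega>" and wg: "weak_grad \<Omega> u g"
  shows "(LINT x|lebesgue_on \<Omega>. norm (wgrad \<Omega> u x) powr p) = (LINT x|lebesgue_on \<Omega>. norm (g x) powr p)"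
proof (rule integral_cong_AE)
  show "(\<lambda>x. norm (wgrad \<Omega> u x) powr p) \<in> borel_measurable (lebesgue_on \<Omega>)"
    "(\<lambda>x. norm (g x) powr p) \<in> borel_measurable (lebesgue_on \<Omega>)"
    using wg weak_grad_wgrad[OF wg] by (auto simp: weak_grad_def L1_loc_def)
  have "AE x in lebesgue_on \<Omega>. wgrad \<Omega> u x = g x"
    using weak_grad_unique[OF \<Omega> weak_grad_wgrad[OF wg] wg] \<Omega>
    by (simp add: AE_restrict_space_iff)
  then show "AE x in lebesgue_on \<Omega>. norm (wgrad \<Omega> u x) powr p = norm (g x) powr p"
    by (rule eventually_mono) simp
qed

text \<open>This is the derivative of sin (t h) at h = 0, taken along h = 1/(k+1).\<close>

lemma scaled_sin_tendsto: "(\<lambda>k. real (Suc k) * sin (t / real (Suc k))) \<longlonglongrightarrow> t"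
proof -
  have "((\<lambda>h. sin (t * h)) has_real_derivative t) (at 0)"
    by (auto intro!: derivative_eq_intros)
  then have "((\<lambda>h. sin (t * h) / h) \<longlongrightarrow> t) (at 0)"
    by (simp add: DERIV_def)
  moreover have "filterlim (\<lambda>k. inverse (real (Suc k))) (at 0) sequentially"
    using LIMSEQ_inverse_real_of_nat by (simp add: filterlim_at)
  ultimately have "(\<lambda>k. sin (t * inverse (real (Suc k))) / inverse (real (Suc k))) \<longlonglongrightarrow> t"
    by (rule filterlim_compose)
  then show ?thesis by (simp add: divide_inverse mult.commute)
qed

text \<open>The mean values of \<open>k sin (u/k)\<close> stay bounded in \<open>k\<close> since \<open>u\<close> is bounded on a set of positive measure.\<close>
lemma poincare_domain_L1p_imp_W1p:
  fixes \<Omega> :: "'a::euclidean_space set"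
  assumes p: "p \<ge> 1" and poin: "poincare_domain p \<Omega>" and u: "L1p \<Omega> p u"
  shows "W1p \<Omega> p u"
proof -
  have \<Omega>: "open \<Omega>" "bounded \<Omega>" "\<Omega> \<noteq> {}"
    using poin by (auto simp: poincare_domain_def is_domain_def)
  have \<Omega>l: "\<Omega> \<in> lmeasurable" using \<Omega> by (simp add: lmeasurable_open)
  then have \<Omega>s: "\<Omega> \<in> sets lebesgue" by auto
  note si = set_integral_lebesgue_on[OF \<Omega>s]
  define N where "N = lebesgue_on \<Omega>"
  interpret N: finite_measure N
    unfolding N_def using \<Omega>l by (rule finite_measure_lebesgue_on)
  obtain C where C: "C > 0" "\<And>v. W1p \<Omega> p v \<Longrightarrow>
      (LINT x|N. \<bar>v x - (LINT y|N. v y) / measure lebesgue \<Omega>\<bar> powr p) \<le> C * (LINT x|N. norm (wgrad \<Omega> v x) powr p)"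
    using poin unfolding poincare_domain_def si N_def by blast
  obtain g where g: "weak_grad \<Omega> u g" and gp: "integrable N (\<lambda>x. norm (g x) powr p)"
    using u unfolding L1p_def si N_def by blast
  have [measurable]: "u \<in> borel_measurable N" "g \<in> borel_measurable N"
    using g by (auto simp: weak_grad_def L1_loc_def N_def)
  define I where "I = (LINT x|N. norm (g x) powr p)"
  define v where "v k x = real (Suc k) * sin (u x / real (Suc k))" for k x
  define c where "c k = (LINT y|N. v k y) / measure lebesgue \<Omega>" for k
  have [measurable]: "v k \<in> borel_measurable N" for k unfolding v_def by measurable
  have vk: "\<bar>v k x\<bar> \<le> real (Suc k)" for k x
    using mult_left_mono[OF abs_sin_le_one, of "real (Suc k)" "u x / real (Suc k)"]
    unfolding v_def abs_mult by simp
  have vu: "\<bar>v k x\<bar> \<le> \<bar>u x\<bar>" for k x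
    using mult_left_mono[OF abs_sin_x_le_abs_x, of "real (Suc k)" "u x / real (Suc k)"]
    unfolding v_def abs_mult abs_divide by simp
  \<comment> \<open>Used with d = 0 for membership in L^p and with d = - c k for the deviation from
    the mean value; both are bounded functions on a set of finite measure.\<close>
  have int_v: "integrable N (\<lambda>x. \<bar>v k x + d\<bar> powr p)" for k d
  proof (rule N.integrable_const_bound)
    show "AE x in N. norm (\<bar>v k x + d\<bar> powr p) \<le> (real (Suc k) + \<bar>d\<bar>) powr p"
    proof (rule AE_I2)
      fix x
      have "\<bar>v k x + d\<bar> \<le> real (Suc k) + \<bar>d\<bar>"
        using vk[of k x] abs_triangle_ineq[of "v k x" d] by linarith
      then show "norm (\<bar>v k x + d\<bar> powr p) \<le> (real (Suc k) + \<bar>d\<bar>) powr p"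
        using p by (simp add: powr_mono2)
    qed
  qed measurable
  have wgv: "weak_grad \<Omega> (v k) (\<lambda>x. cos (u x / real (Suc k)) *\<^sub>R g x)" for k
    unfolding v_def
  proof (rule weak_grad_compose[of _ _ 1, OF _ _ _ \<Omega>(1) g])
    show "((\<lambda>t. real (Suc k) * sin (t / real (Suc k))) has_real_derivative cos (t / real (Suc k))) (at t)" for t
      by (auto intro!: derivative_eq_intros)
    show "continuous_on UNIV (\<lambda>t. cos (t / real (Suc k)))"
      by (intro continuous_intros) simp
  qed simp
  have le_g: "norm (cos (u x / real (Suc k)) *\<^sub>R g x) powr p \<le> norm (g x) powr p" for k x
    using p mult_right_mono[OF abs_cos_le_one, of "norm (g x)" "u x / real (Suc k)"]
    by (intro powr_mono2) auto
  have int_gv: "integrable N (\<lambda>x. norm (cos (u x / real (Suc k)) *\<^sub>R g x) powr p)" for k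
    by (rule Bochner_Integration.integrable_bound[OF gp]) (use le_g in auto)
  have "integrable N (\<lambda>x. \<bar>v k x\<bar> powr p)" for k using int_v[of k 0] by simp
  then have "W1p \<Omega> p (v k)" for k
    using wgv int_gv unfolding W1p_def L1p_def si N_def by blast
  then have "(LINT x|N. \<bar>v k x - c k\<bar> powr p) \<le> C * (LINT x|N. norm (wgrad \<Omega> (v k) x) powr p)" for k
    unfolding c_def by (rule C(2))
  moreover have "(LINT x|N. norm (wgrad \<Omega> (v k) x) powr p) \<le> I" for k
    unfolding N_def integral_wgrad[OF \<Omega>(1) wgv] unfolding N_def[symmetric] I_def
    by (rule integral_mono[OF int_gv gp le_g])
  ultimately have CI: "(LINT x|N. \<bar>v k x - c k\<bar> powr p) \<le> C * I" for k
    using C(1) by (meson mult_left_mono less_imp_le order_trans)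
  \<comment> \<open>The sets where |u| \<le> R exhaust Omega as R grows; if all were null sets, so
    would be the nonempty open Omega.\<close>
  obtain R :: nat where R: "measure N {x\<in>space N. \<bar>u x\<bar> \<le> real R} > 0"
  proof (rule ccontr)
    assume "\<not> thesis"
    then have "measure N {x\<in>space N. \<bar>u x\<bar> \<le> real R} = 0" for R
      using that by (metis measure_nonneg less_eq_real_def)
    then have "{x\<in>space N. \<bar>u x\<bar> \<le> real R} \<in> null_sets N" for R
      by (intro null_setsI) (simp_all add: N.emeasure_eq_measure)
    then have "(\<Union>R. {x\<in>space N. \<bar>u x\<bar> \<le> real R}) \<in> null_sets N" by blast
    moreover have "(\<Union>R. {x\<in>space N. \<bar>u x\<bar> \<le> real R}) = \<Omega>"
      using real_arch_simple by (auto simp: N_def)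
    ultimately have "\<Omega> \<in> null_sets lebesgue"
      using \<Omega>s by (simp add: N_def null_sets_restrict_space)
    then show False
      using open_not_negligible[OF \<Omega>(1,3)] by (simp add: negligible_iff_null_sets)
  qed
  define A where "A = {x\<in>space N. \<bar>u x\<bar> \<le> real R}"
  have A[measurable]: "A \<in> sets N" unfolding A_def by measurable
  \<comment> \<open>Integrate |c k|^p \<le> 2^p (|v k - c k|^p + |v k|^p) over A, where |v k| \<le>
    |u| \<le> R, and divide by the positive measure of A.\<close>
  define B0 where "B0 = 2 powr p * (C * I + real R powr p * measure N A) / measure N A"
  have iA: "integrable N (indicator A :: 'a \<Rightarrow> real)"
    by (simp add: N.emeasure_eq_measure)
  have c_bound: "\<bar>c k\<bar> powr p \<le> B0" for k
  proof -
    have ic: "integrable N (\<lambda>x. \<bar>v k x - c k\<bar> powr p)" using int_v[of k "- c k"] by simp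
    have "\<bar>c k\<bar> powr p * indicator A x
        \<le> 2 powr p * (\<bar>v k x - c k\<bar> powr p + real R powr p * indicator A x)" for x
    proof (cases "x \<in> A")
      case True
      have "\<bar>c k\<bar> powr p \<le> 2 powr p * (\<bar>c k - v k x\<bar> powr p + \<bar>v k x\<bar> powr p)"
        using powr_abs_add_le[of p "c k - v k x" "v k x"] p by simp
      also have "\<bar>v k x\<bar> powr p \<le> real R powr p"
        using True vu[of k x] p unfolding A_def by (intro powr_mono2) auto
      finally show ?thesis using True by (simp add: abs_minus_commute)
    qed simp
    then have "(LINT x|N. \<bar>c k\<bar> powr p * indicator A x)
        \<le> (LINT x|N. 2 powr p * (\<bar>v k x - c k\<bar> powr p + real R powr p * indicator A x))"
      using ic iA by (intro integral_mono) auto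
    also have "\<dots> = 2 powr p * ((LINT x|N. \<bar>v k x - c k\<bar> powr p) + real R powr p * measure N A)"
      using ic iA by simp
    also have "\<dots> \<le> 2 powr p * (C * I + real R powr p * measure N A)"
      using CI by (intro mult_left_mono add_right_mono) auto
    finally have "\<bar>c k\<bar> powr p * measure N A \<le> 2 powr p * (C * I + real R powr p * measure N A)"
      using iA by simp
    then show ?thesis using R unfolding B0_def A_def by (simp add: pos_le_divide_eq)
  qed
  \<comment> \<open>The same splitting over all of Omega, now for v k = (v k - c k) + c k with |c
    k|^p \<le> B0.\<close>
  define B1 where "B1 = 2 powr p * (C * I + B0 * measure N (space N))"
  have v_bound: "(LINT x|N. \<bar>v k x\<bar> powr p) \<le> B1" for k
  proof -
    have ic: "integrable N (\<lambda>x. \<bar>v k x - c k\<bar> powr p)" using int_v[of k "- c k"] by simp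
    have "\<bar>v k x\<bar> powr p \<le> 2 powr p * (\<bar>v k x - c k\<bar> powr p + B0)" for x
    proof -
      have "\<bar>v k x\<bar> powr p \<le> 2 powr p * (\<bar>v k x - c k\<bar> powr p + \<bar>c k\<bar> powr p)"
        using powr_abs_add_le[of p "v k x - c k" "c k"] p by simp
      also have "\<dots> \<le> 2 powr p * (\<bar>v k x - c k\<bar> powr p + B0)"
        using c_bound by (intro mult_left_mono add_left_mono) auto
      finally show ?thesis .
    qed
    then have "(LINT x|N. \<bar>v k x\<bar> powr p) \<le> (LINT x|N. 2 powr p * (\<bar>v k x - c k\<bar> powr p + B0))"
      using ic int_v[of k 0] by (intro integral_mono) auto
    also have "\<dots> = 2 powr p * ((LINT x|N. \<bar>v k x - c k\<bar> powr p) + B0 * measure N (space N))"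
      using ic by (simp add: mult.commute)
    also have "\<dots> \<le> B1"
      unfolding B1_def using CI by (intro mult_left_mono add_right_mono) auto
    finally show ?thesis .
  qed
  have "integrable N (\<lambda>x. \<bar>u x\<bar> powr p)"
  proof (rule integrableI_bounded)
    have lim: "(\<lambda>k. ennreal (\<bar>v k x\<bar> powr p)) \<longlonglongrightarrow> ennreal (\<bar>u x\<bar> powr p)" for x
    proof -
      have "(\<lambda>k. \<bar>v k x\<bar>) \<longlonglongrightarrow> \<bar>u x\<bar>"
        unfolding v_def by (intro tendsto_rabs scaled_sin_tendsto)
      then show ?thesis
        \<comment> \<open>At zeros of u, convergence of the powers rests on p > 0 and on the bases
          being nonnegative.\<close>
        using p by (intro tendsto_ennrealI tendsto_powr') auto
    qed
    have "(\<integral>\<^sup>+x. ennreal (norm (\<bar>u x\<bar> powr p)) \<partial>N) = (\<integral>\<^sup>+x. liminf (\<lambda>k. ennreal (\<bar>v k x\<bar> powr p)) \<partial>N)"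
      using lim_imp_Liminf[OF _ lim] by simp
    also have "\<dots> \<le> liminf (\<lambda>k. \<integral>\<^sup>+x. ennreal (\<bar>v k x\<bar> powr p) \<partial>N)"
      by (rule nn_integral_liminf) measurable
    also have "\<dots> \<le> liminf (\<lambda>k. ennreal B1)"
    proof (intro Liminf_mono always_eventually allI)
      fix k
      have "(\<integral>\<^sup>+x. ennreal (\<bar>v k x\<bar> powr p) \<partial>N) = ennreal (LINT x|N. \<bar>v k x\<bar> powr p)"
        using int_v[of k 0] by (intro nn_integral_eq_integral) auto
      then show "(\<integral>\<^sup>+x. ennreal (\<bar>v k x\<bar> powr p) \<partial>N) \<le> ennreal B1"
        using v_bound[of k] by (simp add: ennreal_leI)
    qed
    also have "\<dots> < \<infinity>" by (simp add: Liminf_const)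
    finally show "(\<integral>\<^sup>+x. ennreal (norm (\<bar>u x\<bar> powr p)) \<partial>N) < \<infinity>" .
  qed measurable
  then show ?thesis using u unfolding W1p_def si N_def by blast
qed

section \<open>Adding constants and the extension operator\<close>

lemma L1p_add_const: "open \<Omega> \<Longrightarrow> L1p \<Omega> p (\<lambda>x. u x + c) \<longleftrightarrow> L1p \<Omega> p u"
  by (simp add: L1p_def weak_grad_add_const)

lemma L1p_norm_add_const: "open \<Omega> \<Longrightarrow> L1p_norm \<Omega> p (\<lambda>x. u x + c) = L1p_norm \<Omega> p u"
  by (simp add: L1p_norm_def wgrad_add_const)

text \<open>Boundedness of Omega puts constants into L^p.\<close>

lemma W1p_add_const:
  fixes \<Omega> :: "'a::euclidean_space set"
  assumes \<Omega>: "open \<Omega>" "bounded \<Omega>" and p: "p \<ge> 0" and u: "W1p \<Omega> p u"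
  shows "W1p \<Omega> p (\<lambda>x. u x + c)"
proof -
  have \<Omega>l: "\<Omega> \<in> lmeasurable" using \<Omega> by (simp add: lmeasurable_open)
  then have \<Omega>s: "\<Omega> \<in> sets lebesgue" by auto
  note si = set_integral_lebesgue_on[OF \<Omega>s]
  interpret finite_measure "lebesgue_on \<Omega>"
    using \<Omega>l by (rule finite_measure_lebesgue_on)
  have [measurable]: "u \<in> borel_measurable (lebesgue_on \<Omega>)"
    using u by (auto simp: W1p_def L1p_def weak_grad_def L1_loc_def)
  have "integrable (lebesgue_on \<Omega>) (\<lambda>x. 2 powr p * (\<bar>u x\<bar> powr p + \<bar>c\<bar> powr p))"
    using u by (simp add: W1p_def si)
  then have "integrable (lebesgue_on \<Omega>) (\<lambda>x. \<bar>u x + c\<bar> powr p)"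
  proof (rule Bochner_Integration.integrable_bound)
    show "AE x in lebesgue_on \<Omega>. norm (\<bar>u x + c\<bar> powr p) \<le> norm (2 powr p * (\<bar>u x\<bar> powr p + \<bar>c\<bar> powr p))"
      using powr_abs_add_le[OF p] by (intro AE_I2) simp
  qed measurable
  then show ?thesis using u \<Omega>(1) by (simp add: W1p_def L1p_add_const si)
qed

theorem theorem1p2:
  fixes \<Omega> :: "'a::euclidean_space set" and p q :: real
  assumes "1 \<le> q" and "q \<le> p"
    and "poincare_domain p \<Omega>"
    and "extension_domain \<Omega> (W1p \<Omega> p) (W1p_norm \<Omega> p) (W1p UNIV q) (W1p_norm UNIV q)"
  shows "extension_domain \<Omega> (L1p \<Omega> p) (L1p_norm \<Omega> p) (L1p UNIV q) (L1p_norm UNIV q)"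
proof -
  have p: "p \<ge> 1" using assms by simp
  have \<Omega>: "open \<Omega>" "bounded \<Omega>"
    using assms(3) by (auto simp: poincare_domain_def is_domain_def)
  define mean where "mean u = (LINT y:\<Omega>|lebesgue. u y) / measure lebesgue \<Omega>" for u
  obtain C where C: "C > 0" "\<And>u. W1p \<Omega> p u \<Longrightarrow> (LINT x:\<Omega>|lebesgue. \<bar>u x - mean u\<bar> powr p)
      \<le> C * (LINT x:\<Omega>|lebesgue. norm (wgrad \<Omega> u x) powr p)"
    using assms(3) unfolding poincare_domain_def mean_def by blast
  obtain E D where D: "D > 0" and E: "\<And>u. W1p \<Omega> p u \<Longrightarrow> W1p UNIV q (E u)"
    "\<And>u. W1p \<Omega> p u \<Longrightarrow> AE x in lebesgue. x \<in> \<Omega> \<longrightarrow> E u x = u x"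
    "\<And>u. W1p \<Omega> p u \<Longrightarrow> W1p_norm UNIV q (E u) \<le> D * W1p_norm \<Omega> p u"
    using assms(4) unfolding extension_domain_def by blast
  \<comment> \<open>Subtraction is written as adding \<open>- mean u\<close>, the form of the lemmas
    on added constants. E is applied to a function whose full norm the gradient of u
    controls.\<close>
  define F where "F u x = E (\<lambda>y. u y + - mean u) x + mean u" for u x
  have "L1p UNIV q (F u) \<and> (AE x in lebesgue. x \<in> \<Omega> \<longrightarrow> F u x = u x)
      \<and> L1p_norm UNIV q (F u) \<le> (D * (C + 1) powr (1 / p)) * L1p_norm \<Omega> p u"
    if u: "L1p \<Omega> p u" for u
  proof -
    let ?v = "\<lambda>y. u y + - mean u"
    let ?X = "LINT x:\<Omega>|lebesgue. norm (wgrad \<Omega> u x) powr p"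
    have Wu: "W1p \<Omega> p u" using p assms(3) u by (rule poincare_domain_L1p_imp_W1p)
    then have Wv: "W1p \<Omega> p ?v" using \<Omega> p by (intro W1p_add_const) auto
    \<comment> \<open>A nonzero constant is not in L^q of the whole space, so restoring the mean
      value leaves W^{1,q}; it stays in L^{1,q} with the same gradient.\<close>
    have "L1p UNIV q (F u)"
      using E(1)[OF Wv] unfolding F_def L1p_add_const[OF open_UNIV] W1p_def by blast
    moreover have "AE x in lebesgue. x \<in> \<Omega> \<longrightarrow> F u x = u x"
      using E(2)[OF Wv] by (rule eventually_mono) (simp add: F_def)
    moreover have "L1p_norm UNIV q (F u) \<le> (D * (C + 1) powr (1 / p)) * L1p_norm \<Omega> p u"
    proof -
      have X: "?X \<ge> 0" by (auto simp: set_lebesgue_integral_def intro!: integral_nonneg_AE)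
      have "L1p_norm UNIV q (F u) = L1p_norm UNIV q (E ?v)"
        unfolding F_def by (rule L1p_norm_add_const[OF open_UNIV])
      \<comment> \<open>Only the gradient of the extension is measured, so the nonnegative L^q term
        may be added.\<close>
      also have "\<dots> \<le> W1p_norm UNIV q (E ?v)"
        unfolding L1p_norm_def W1p_norm_def using assms(1)
        by (intro powr_mono2) (auto simp: set_lebesgue_integral_def intro!: integral_nonneg_AE)
      also have "\<dots> \<le> D * W1p_norm \<Omega> p ?v" using Wv by (rule E(3))
      \<comment> \<open>The inequality is applied to u itself, whose deviation from the mean value
        is the shifted function. Its C and the gradient term, unchanged by the shift, add up to C +
        1.\<close>
      also have "W1p_norm \<Omega> p ?v \<le> ((C + 1) * ?X) powr (1 / p)"
        unfolding W1p_norm_def wgrad_add_const[OF \<Omega>(1)]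
      proof (rule powr_mono2)
        show "(LINT x:\<Omega>|lebesgue. \<bar>u x + - mean u\<bar> powr p) + ?X \<le> (C + 1) * ?X"
          using C(2)[OF Wu] by (simp add: algebra_simps)
        show "0 \<le> (LINT x:\<Omega>|lebesgue. \<bar>u x + - mean u\<bar> powr p) + ?X"
          using X by (intro add_nonneg_nonneg) (auto simp: set_lebesgue_integral_def intro!: integral_nonneg_AE)
      qed (use p in simp)
      also have "\<dots> = (C + 1) powr (1 / p) * L1p_norm \<Omega> p u"
        unfolding L1p_norm_def using C(1) X by (simp add: powr_mult)
      finally show ?thesis using D by (simp add: mult.assoc)
    qed
    ultimately show ?thesis by blast
  qed
  moreover have "D * (C + 1) powr (1 / p) > 0" using C(1) D by simp
  ultimately show ?thesis unfolding extension_domain_def by blast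
qed

end
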